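(* Let $G=(V,E)$ be an infinite, connected, locally finite simple graph such that the wired spanning forest of $G$ is $\mu$-a.s. connected (a single tree) and has one end. Then there exists a probability measure $\nu$ on $\Omega_G=\prod_{x\in V}\{0,\dots,\deg_G(x)-1\}$ such that $\nu_{G_n}\Rightarrow\nu$ (weak convergence, i.e. convergence of all finite-dimensional marginals) for every exhaustion $V_1\subset V_2\subset\cdots$ of $V$, and $\nu$ does not depend on the exhaustion.
   Context: An exhaustion of $V$ is a sequence of finite sets $V_1\subset V_2\subset\cdots$ with $\bigcup_nV_n=V$. The wired graph $G_n$ is obtained from $G$ by identifying all vertices of $V\setminus V_n$ to a single vertex $s$ (the sink) and removing loops at $s$; thus every $x\in V_n$ has $\deg_{G_n}(x)=\deg_G(x)$. $\mu_{G_n}$ is the uniform measure on spanning trees of $G_n$; the wired spanning forest (WSF) measure $\mu$ on $\{0,1\}^E$ is the weak limit of $\mu_{G_n}$, which exists, is independent of the exhaustion, and is concentrated on spanning forests all of whose components are infinite. An infinite tree has one end if any two infinite self-avoiding paths in it share infinitely many vertices. $\nu_{G_n}$ is the stationary distribution of the Abelian sandpile Markov chain on $G_n$ with sink $s$ (uniform on recurrent configurations; the chain adds a particle at a random vertex of $V_n$ and stabilizes by topplings, a vertex $x$ with at least $\deg(x)$ particles sending one particle to each neighbour, particles sent to $s$ being lost), a measure on $\prod_{x\in V_n}\{0,\dots,\deg_G(x)-1\}$. *)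

theory Defs
  imports "HOL-Probability.Probability"
begin

definition simple_graph :: "'a set \<Rightarrow> ('a \<Rightarrow> 'a \<Rightarrow> bool) \<Rightarrow> bool" where
  "simple_graph V adj \<longleftrightarrow>
     (\<forall>x y. adj x y \<longrightarrow> adj y x) \<and> (\<forall>x. \<not> adj x x) \<and>
     (\<forall>x y. adj x y \<longrightarrow> x \<in> V \<and> y \<in> V)"

definition locally_finite :: "'a set \<Rightarrow> ('a \<Rightarrow> 'a \<Rightarrow> bool) \<Rightarrow> bool" where
  "locally_finite V adj \<longleftrightarrow> (\<forall>x\<in>V. finite {y. adj x y})"

definition graph_connected :: "'a set \<Rightarrow> ('a \<Rightarrow> 'a \<Rightarrow> bool) \<Rightarrow> bool" where
  "graph_connected V adj \<longleftrightarrow> (\<forall>x\<in>V. \<forall>y\<in>V. adj\<^sup>*\<^sup>* x y)"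

definition edges :: "('a \<Rightarrow> 'a \<Rightarrow> bool) \<Rightarrow> 'a set set" where
  "edges adj = {{x, y} | x y. adj x y}"

definition deg :: "('a \<Rightarrow> 'a \<Rightarrow> bool) \<Rightarrow> 'a \<Rightarrow> nat" where
  "deg adj x = card {y. adj x y}"

definition exhaustion :: "'a set \<Rightarrow> (nat \<Rightarrow> 'a set) \<Rightarrow> bool" where
  "exhaustion V Vn \<longleftrightarrow>
     (\<forall>n. finite (Vn n) \<and> Vn n \<subseteq> Vn (Suc n)) \<and> (\<Union>n. Vn n) = V"

text \<open>The wired graph G_W (W finite): vertices of V - W are identified with the sink,
represented as None; a vertex x of W is represented as Some x. Edges of G_W are
the edges of G with at least one endpoint in W (edges with both endpoints outside W
become loops at the sink and are removed); parallel edges to the sink are kept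
distinct since they are distinct edges of G.\<close>

definition wq :: "'a set \<Rightarrow> 'a \<Rightarrow> 'a option" where
  "wq W x = (if x \<in> W then Some x else None)"

definition wired_edges :: "('a \<Rightarrow> 'a \<Rightarrow> bool) \<Rightarrow> 'a set \<Rightarrow> 'a set set" where
  "wired_edges adj W = {e \<in> edges adj. e \<inter> W \<noteq> {}}"

definition wired_conn :: "'a set \<Rightarrow> 'a set set \<Rightarrow> 'a option \<Rightarrow> 'a option \<Rightarrow> bool" where
  "wired_conn W T = (\<lambda>u v. \<exists>x y. {x, y} \<in> T \<and> x \<noteq> y \<and> wq W x = u \<and> wq W y = v)\<^sup>*\<^sup>*"

definition wired_spanning_tree :: "('a \<Rightarrow> 'a \<Rightarrow> bool) \<Rightarrow> 'a set \<Rightarrow> 'a set set \<Rightarrow> bool" where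
  "wired_spanning_tree adj W T \<longleftrightarrow>
     T \<subseteq> wired_edges adj W \<and>
     (\<forall>x\<in>W. wired_conn W T (Some x) None) \<and>
     (\<forall>e\<in>T. \<forall>x y. e = {x, y} \<longrightarrow> \<not> wired_conn W (T - {e}) (wq W x) (wq W y))"

definition wired_ust :: "('a \<Rightarrow> 'a \<Rightarrow> bool) \<Rightarrow> 'a set \<Rightarrow> 'a set set pmf" where
  "wired_ust adj W = pmf_of_set {T. wired_spanning_tree adj W T}"

definition edge_space :: "('a \<Rightarrow> 'a \<Rightarrow> bool) \<Rightarrow> ('a set \<Rightarrow> bool) measure" where
  "edge_space adj = PiM (edges adj) (\<lambda>_. count_space UNIV)"

definition open_edges :: "('a \<Rightarrow> 'a \<Rightarrow> bool) \<Rightarrow> ('a set \<Rightarrow> bool) \<Rightarrow> 'a set set" where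
  "open_edges adj \<omega> = {e \<in> edges adj. \<omega> e}"

definition forest_conn :: "'a set set \<Rightarrow> 'a \<Rightarrow> 'a \<Rightarrow> bool" where
  "forest_conn F = (\<lambda>x y. {x, y} \<in> F \<and> x \<noteq> y)\<^sup>*\<^sup>*"

definition single_tree :: "'a set \<Rightarrow> 'a set set \<Rightarrow> bool" where
  "single_tree V F \<longleftrightarrow>
     (\<forall>x\<in>V. \<forall>y\<in>V. forest_conn F x y) \<and>
     (\<forall>e\<in>F. \<forall>x y. e = {x, y} \<longrightarrow> \<not> forest_conn (F - {e}) x y)"

definition inf_sa_path :: "'a set set \<Rightarrow> (nat \<Rightarrow> 'a) \<Rightarrow> bool" where
  "inf_sa_path F p \<longleftrightarrow> inj p \<and> (\<forall>i. {p i, p (Suc i)} \<in> F)"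

definition one_ended :: "'a set set \<Rightarrow> bool" where
  "one_ended F \<longleftrightarrow>
     (\<forall>p q. inf_sa_path F p \<and> inf_sa_path F q \<longrightarrow> infinite (range p \<inter> range q))"

definition is_WSF :: "'a set \<Rightarrow> ('a \<Rightarrow> 'a \<Rightarrow> bool) \<Rightarrow> ('a set \<Rightarrow> bool) measure \<Rightarrow> bool" where
  "is_WSF V adj \<mu> \<longleftrightarrow>
     prob_space \<mu> \<and> sets \<mu> = sets (edge_space adj) \<and>
     (\<forall>Vn. exhaustion V Vn \<longrightarrow>
        (\<forall>K A. finite K \<and> K \<subseteq> edges adj \<and> A \<subseteq> K \<longrightarrow>
          (\<lambda>n. measure_pmf.prob (wired_ust adj (Vn n)) {T. T \<inter> K = A})
            \<longlonglongrightarrow> measure \<mu> {\<omega> \<in> space \<mu>. \<forall>e\<in>K. \<omega> e \<longleftrightarrow> e \<in> A}))"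

definition stable :: "('a \<Rightarrow> 'a \<Rightarrow> bool) \<Rightarrow> 'a set \<Rightarrow> ('a \<Rightarrow> nat) \<Rightarrow> bool" where
  "stable adj W \<eta> \<longleftrightarrow> (\<forall>x\<in>W. \<eta> x < deg adj x)"

definition stable_configs :: "('a \<Rightarrow> 'a \<Rightarrow> bool) \<Rightarrow> 'a set \<Rightarrow> ('a \<Rightarrow> nat) set" where
  "stable_configs adj W = {\<eta>. (\<forall>y. y \<notin> W \<longrightarrow> \<eta> y = 0) \<and> stable adj W \<eta>}"

definition topple_step :: "('a \<Rightarrow> 'a \<Rightarrow> bool) \<Rightarrow> 'a set \<Rightarrow> ('a \<Rightarrow> nat) \<Rightarrow> ('a \<Rightarrow> nat) \<Rightarrow> bool" where
  "topple_step adj W \<eta> \<zeta> \<longleftrightarrow>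
     (\<exists>x\<in>W. deg adj x \<le> \<eta> x \<and>
        \<zeta> = (\<lambda>y. if y = x then \<eta> y - deg adj x
                  else if y \<in> W \<and> adj x y then \<eta> y + 1 else \<eta> y))"

definition sandpile_step :: "('a \<Rightarrow> 'a \<Rightarrow> bool) \<Rightarrow> 'a set \<Rightarrow> ('a \<Rightarrow> nat) \<Rightarrow> ('a \<Rightarrow> nat) \<Rightarrow> bool" where
  "sandpile_step adj W \<eta> \<zeta> \<longleftrightarrow>
     \<eta> \<in> stable_configs adj W \<and>
     (\<exists>x\<in>W. (topple_step adj W)\<^sup>*\<^sup>* (\<eta>(x := \<eta> x + 1)) \<zeta> \<and> stable adj W \<zeta>)"

definition recurrent :: "('a \<Rightarrow> 'a \<Rightarrow> bool) \<Rightarrow> 'a set \<Rightarrow> ('a \<Rightarrow> nat) \<Rightarrow> bool" where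
  "recurrent adj W \<eta> \<longleftrightarrow>
     \<eta> \<in> stable_configs adj W \<and>
     (\<forall>\<zeta>. (sandpile_step adj W)\<^sup>*\<^sup>* \<eta> \<zeta> \<longrightarrow> (sandpile_step adj W)\<^sup>*\<^sup>* \<zeta> \<eta>)"

text \<open>nu_{G_W}: the stationary distribution, uniform on recurrent configurations.\<close>
definition sandpile_measure :: "('a \<Rightarrow> 'a \<Rightarrow> bool) \<Rightarrow> 'a set \<Rightarrow> ('a \<Rightarrow> nat) pmf" where
  "sandpile_measure adj W = pmf_of_set {\<eta>. recurrent adj W \<eta>}"

definition Omega :: "'a set \<Rightarrow> ('a \<Rightarrow> 'a \<Rightarrow> bool) \<Rightarrow> ('a \<Rightarrow> nat) measure" where
  "Omega V adj = PiM V (\<lambda>x. count_space {0..<deg adj x})"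

end

theory Submission
  imports Defs
begin

text \<open>
Fix a finite set K.  In a spanning tree rooted at the sink, let D be K together with all descendants
of K; in a recurrent configuration, let D be the set left unburnt when all vertices outside K that
can be burnt, and none of K, are burnt.  Given D, the restriction to D of either object is uniform on
a set which does not depend on the volume, while the outside is a spanning tree (respectively an
allowed configuration) of the graph with D removed.  Spanning trees and allowed configurations of any
wired graph are equinumerous, as both counts satisfy the same deletion-contraction recursion for
edges to the sink; so D has the same law in both models.  If the wired spanning forest is a
one-ended tree, then D is almost surely finite in infinite volume, so no mass of the law of D
escapes, and the sandpile marginals on K converge.  Kolmogorov extension yields the limit measure.
\<close>

section \<open>Spanning trees and allowed configurations of wired graphs\<close>

text \<open>Trees and configurations are never matched one by one. The number of trees with exit set
  \<open>D\<close> is bounded above by an inner count times an outer count, while gluing inner and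
  outer configurations bounds the number of configurations below by products of the same kind. Equal
  cardinalities are used three times: for the wired graph itself, which gives both laws the same
  denominator; for what remains outside \<open>D\<close>; and inside \<open>D\<close>, where they
  make the conditional laws on \<open>K\<close> sum to one. Sandpile probabilities are thus bounded
  below by averages over the tree, and as these averages have total mass one in the limit, the lower
  bounds are sharp. The obstacle is that the tree converges only on finitely many edges at a time,
  while being a descendant is a global property. This is why the event that \<open>D\<close> is the
  exit set is phrased as a condition on the finitely many edges meeting \<open>D\<close>.\<close>

text \<open>All points outside W represent the sink.  Contracting an edge from x to the sink therefore
amounts to removing x from W; the edges between x and the sink become loops and are dropped.\<close>

definition wconn :: "'a set \<Rightarrow> 'a set set \<Rightarrow> 'a \<Rightarrow> 'a \<Rightarrow> bool" where
  "wconn W T = (\<lambda>x y. {x, y} \<in> T \<or> x \<notin> W \<and> y \<notin> W)\<^sup>*\<^sup>*"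

definition wired_connected :: "'a set \<Rightarrow> 'a set set \<Rightarrow> bool" where
  "wired_connected W T \<longleftrightarrow> (\<forall>x\<in>W. \<exists>s. s \<notin> W \<and> wconn W T x s)"

definition wired_acyclic :: "'a set \<Rightarrow> 'a set set \<Rightarrow> bool" where
  "wired_acyclic W T \<longleftrightarrow> (\<forall>x y. {x, y} \<in> T \<longrightarrow> \<not> wconn W (T - {{x, y}}) x y)"

definition wired_trees :: "'a set \<Rightarrow> 'a set set \<Rightarrow> 'a set set set" where
  "wired_trees W E = {T. T \<subseteq> E \<and> wired_connected W T \<and> wired_acyclic W T}"

definition wired_graph :: "'a set \<Rightarrow> 'a set set \<Rightarrow> bool" where
  "wired_graph W E \<longleftrightarrow> finite W \<and> finite E \<and> (\<forall>e\<in>E. card e = 2 \<and> e \<inter> W \<noteq> {})"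

definition edge_deg :: "'a set set \<Rightarrow> 'a \<Rightarrow> nat" where
  "edge_deg E x = card {e \<in> E. x \<in> e}"

definition inner_deg :: "'a set set \<Rightarrow> 'a set \<Rightarrow> 'a \<Rightarrow> nat" where
  "inner_deg E F x = card {e \<in> E. x \<in> e \<and> e \<subseteq> F}"

text \<open>Dhar's burning criterion: a fire started at the sink never stops at a nonempty unburnt
  set \<open>F\<close>, because some vertex of \<open>F\<close> has height at least the number of
  its edges inside \<open>F\<close>.\<close>

definition no_forbidden :: "'a set \<Rightarrow> 'a set set \<Rightarrow> ('a \<Rightarrow> nat) \<Rightarrow> bool" where
  "no_forbidden W E \<eta> \<longleftrightarrow> (\<forall>F. F \<subseteq> W \<longrightarrow> F \<noteq> {} \<longrightarrow> (\<exists>x\<in>F. inner_deg E F x \<le> \<eta> x))"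

definition allowed_configs :: "'a set \<Rightarrow> 'a set set \<Rightarrow> ('a \<Rightarrow> nat) set" where
  "allowed_configs W E =
     {\<eta>. (\<forall>x. x \<notin> W \<longrightarrow> \<eta> x = 0) \<and> (\<forall>x\<in>W. \<eta> x < edge_deg E x) \<and> no_forbidden W E \<eta>}"

lemma no_forbiddenI:
  "(\<And>F. F \<subseteq> W \<Longrightarrow> F \<noteq> {} \<Longrightarrow> \<exists>x\<in>F. inner_deg E F x \<le> \<eta> x) \<Longrightarrow> no_forbidden W E \<eta>"
  by (simp add: no_forbidden_def)

lemma no_forbiddenE:
  assumes "no_forbidden W E \<eta>" "F \<subseteq> W" "F \<noteq> {}"
  obtains x where "x \<in> F" "inner_deg E F x \<le> \<eta> x"
  using assms by (auto simp: no_forbidden_def)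

lemma wconn_refl [simp]: "wconn W T x x"
  by (simp add: wconn_def)

lemma wconn_trans: "wconn W T x y \<Longrightarrow> wconn W T y z \<Longrightarrow> wconn W T x z"
  unfolding wconn_def by (rule rtranclp_trans)

lemma wconn_edge: "{x, y} \<in> T \<Longrightarrow> wconn W T x y"
  by (auto simp: wconn_def)

lemma wconn_outside: "x \<notin> W \<Longrightarrow> y \<notin> W \<Longrightarrow> wconn W T x y"
  by (auto simp: wconn_def)

lemma wconn_sym: "wconn W T x y \<Longrightarrow> wconn W T y x"
proof -
  have "symp (\<lambda>x y. {x, y} \<in> T \<or> x \<notin> W \<and> y \<notin> W)"
    by (auto simp: symp_def insert_commute)
  then show "wconn W T x y \<Longrightarrow> wconn W T y x"
    unfolding wconn_def by (meson symp_rtranclp sympD)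
qed

lemma wconn_induct [consumes 1, case_names refl edge outside]:
  assumes "wconn W T x y" and "P x"
    and "\<And>y z. wconn W T x y \<Longrightarrow> P y \<Longrightarrow> {y, z} \<in> T \<Longrightarrow> P z"
    and "\<And>y z. wconn W T x y \<Longrightarrow> P y \<Longrightarrow> y \<notin> W \<Longrightarrow> z \<notin> W \<Longrightarrow> P z"
  shows "P y"
  using assms(1) unfolding wconn_def
proof (induction rule: rtranclp_induct)
  case (step y z)
  then show ?case using assms(3,4)[of y z] unfolding wconn_def by blast
qed (rule assms(2))

lemma wconn_subst:
  assumes "wconn W T x y"
    and "\<And>a b. {a, b} \<in> T \<Longrightarrow> wconn W' T' a b"
    and "\<And>a b. a \<notin> W \<Longrightarrow> b \<notin> W \<Longrightarrow> wconn W' T' a b"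
  shows "wconn W' T' x y"
  using assms(1) by (induction rule: wconn_induct) (blast intro: wconn_refl wconn_trans assms(2,3))+

lemma wconn_mono:
  "wconn W T x y \<Longrightarrow> W' \<subseteq> W \<Longrightarrow> T \<subseteq> T' \<Longrightarrow> wconn W' T' x y"
  by (erule wconn_subst) (auto intro: wconn_edge wconn_outside)

text \<open>Joining \<open>x\<close> to the sink by an edge and declaring \<open>x\<close> a sink
  point have the same effect on connectivity; the contraction arguments translate between these two
  pictures.\<close>

lemma wconn_contract:
  assumes "x \<in> W" "s \<notin> W"
  shows "wconn (W - {x}) S = wconn W (insert {x, s} S)"
proof (intro ext iffI)
  fix u v
  have out: "wconn W (insert {x, s} S) a s" if "a \<notin> W - {x}" for a
    using that assms by (cases "a = x") (auto intro: wconn_edge wconn_outside)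
  show "wconn W (insert {x, s} S) u v" if "wconn (W - {x}) S u v"
    using that
  proof (rule wconn_subst)
    show "wconn W (insert {x, s} S) a b" if "a \<notin> W - {x}" "b \<notin> W - {x}" for a b
      using out[OF that(1)] wconn_sym[OF out[OF that(2)]] by (rule wconn_trans)
  qed (auto intro: wconn_edge)
  show "wconn (W - {x}) S u v" if "wconn W (insert {x, s} S) u v"
    using that
  proof (rule wconn_subst)
    fix a b assume "{a, b} \<in> insert {x, s} S"
    then show "wconn (W - {x}) S a b"
      using assms by (auto simp: doubleton_eq_iff intro: wconn_edge wconn_outside)
  qed (auto intro: wconn_outside)
qed

text \<open>Cut the path at its last departure from \<open>x\<close>: the rest never
  returns.\<close>

lemma rtranclp_last_visit:
  assumes "R\<^sup>*\<^sup>* x s" "x \<noteq> s"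
  shows "\<exists>y. R x y \<and> (\<lambda>a b. R a b \<and> a \<noteq> x \<and> b \<noteq> x)\<^sup>*\<^sup>* y s"
  using assms(1,2)
proof (induction rule: rtranclp_induct)
  case (step y z)
  show ?case
  proof (cases "x = y")
    case False
    then obtain w where "R x w" "(\<lambda>a b. R a b \<and> a \<noteq> x \<and> b \<noteq> x)\<^sup>*\<^sup>* w y"
      using step.IH by auto
    moreover have "R y z \<and> y \<noteq> x \<and> z \<noteq> x" using False step by auto
    ultimately show ?thesis
      by (intro exI[of _ w]) (auto intro: rtranclp.rtrancl_into_rtrancl)
  qed (use step in auto)
qed simp

text \<open>Trees avoiding the edge are the trees of the deletion; from the others the edge is
  removed by contraction. \<open>E'\<close> drops every edge that contraction turns into a loop at
  the sink, including all parallels of \<open>{x, s}\<close>.\<close>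

lemma wired_trees_delete_contract:
  assumes G: "wired_graph W E" and e: "{x, s} \<in> E" and x: "x \<in> W" and s: "s \<notin> W"
  defines "E' \<equiv> {f \<in> E. f \<inter> (W - {x}) \<noteq> {}}"
  shows "card (wired_trees W E) = card (wired_trees W (E - {{x, s}})) + card (wired_trees (W - {x}) E')"
proof -
  let ?e = "{x, s}"
  have fin: "finite (wired_trees W E)"
    using G by (auto simp: wired_trees_def wired_graph_def intro: finite_subset[of _ "Pow E"])
  have notin: "?e \<notin> E'" using s by (auto simp: E'_def)
  have bij: "bij_betw (insert ?e) (wired_trees (W - {x}) E') {T \<in> wired_trees W E. ?e \<in> T}"
  proof (rule bij_betw_byWitness[where f' = "\<lambda>T. T - {?e}"])
    show "\<forall>S\<in>wired_trees (W - {x}) E'. insert ?e S - {?e} = S"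
      using notin by (auto simp: wired_trees_def)
    show "\<forall>T\<in>{T \<in> wired_trees W E. ?e \<in> T}. insert ?e (T - {?e}) = T" by auto
    show "insert ?e ` wired_trees (W - {x}) E' \<subseteq> {T \<in> wired_trees W E. ?e \<in> T}"
    proof safe
      fix S assume S: "S \<in> wired_trees (W - {x}) E'"
      have SE: "S \<subseteq> E'" and con: "wired_connected (W - {x}) S" and acy: "wired_acyclic (W - {x}) S"
        using S by (auto simp: wired_trees_def)
      have eS: "?e \<notin> S" using SE notin by auto
      note contr = wconn_contract[OF x s]
      have xs: "wconn W (insert ?e S) x s" by (intro wconn_edge) auto
      have "\<exists>s. s \<notin> W \<and> wconn W (insert ?e S) y s" if yW: "y \<in> W" for y
      proof (cases "y = x")
        case True then show ?thesis using xs s by auto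
      next
        case False
        then obtain s' where "s' \<notin> W - {x}" "wconn W (insert ?e S) y s'"
          using con yW contr[of S] by (force simp: wired_connected_def)
        then show ?thesis using s wconn_trans[OF _ xs] by (cases "s' = x") auto
      qed
      moreover have "\<not> wconn W (insert ?e S - {{u, v}}) u v" if uv: "{u, v} \<in> insert ?e S" for u v
      proof (cases "{u, v} = ?e")
        case False
        then have "insert ?e S - {{u, v}} = insert ?e (S - {{u, v}})" by auto
        moreover have "{u, v} \<in> S" using uv False by auto
        ultimately show ?thesis using acy contr by (simp add: wired_acyclic_def)
      next
        case True
        \<comment> \<open>Otherwise the last departure from \<open>x\<close> on a path to
          \<open>s\<close> uses an edge of \<open>S\<close> whose ends stay joined without it, since
          \<open>x\<close> and \<open>s\<close> are identified in the contraction; this contradicts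
          acyclicity of \<open>S\<close> there.\<close>
        have "\<not> wconn W S x s"
        proof
          assume "wconn W S x s"
          then obtain y where y: "{x, y} \<in> S \<or> x \<notin> W \<and> y \<notin> W"
            and ys: "(\<lambda>a b. ({a, b} \<in> S \<or> a \<notin> W \<and> b \<notin> W) \<and> a \<noteq> x \<and> b \<noteq> x)\<^sup>*\<^sup>* y s"
            using rtranclp_last_visit[of "\<lambda>a b. {a, b} \<in> S \<or> a \<notin> W \<and> b \<notin> W" x s] x s
            unfolding wconn_def by blast
          have "(\<lambda>a b. {a, b} \<in> S - {{x, y}} \<or> a \<notin> W \<and> b \<notin> W)\<^sup>*\<^sup>* y s"
            using ys by (rule rtranclp_mono[THEN predicate2D, rotated]) (auto simp: doubleton_eq_iff)
          then have "wconn W (S - {{x, y}}) y s" by (simp add: wconn_def)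
          then have "wconn (W - {x}) (S - {{x, y}}) y s" by (rule wconn_mono) auto
          then have "wconn (W - {x}) (S - {{x, y}}) x y"
            using s by (meson DiffD2 DiffE insertI1 wconn_outside wconn_sym wconn_trans)
          then show False using y x acy by (auto simp: wired_acyclic_def)
        qed
        moreover have "insert ?e S - {{u, v}} = S" using eS True by auto
        moreover have "u = x \<and> v = s \<or> u = s \<and> v = x" using True by (auto simp: doubleton_eq_iff)
        ultimately show ?thesis by (auto dest: wconn_sym)
      qed
      moreover have "insert ?e S \<subseteq> E" using SE e by (auto simp: E'_def)
      ultimately show "insert ?e S \<in> wired_trees W E"
        unfolding wired_trees_def wired_connected_def wired_acyclic_def by blast
    qed
    show "(\<lambda>T. T - {?e}) ` {T \<in> wired_trees W E. ?e \<in> T} \<subseteq> wired_trees (W - {x}) E'"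
    proof safe
      fix T assume T: "T \<in> wired_trees W E" and eT: "?e \<in> T"
      have TE: "T \<subseteq> E" and con: "wired_connected W T" and acy: "wired_acyclic W T"
        using T by (auto simp: wired_trees_def)
      have ins: "insert ?e (T - {?e}) = T" using eT by auto
      note contr = wconn_contract[OF x s, of "T - {?e}", unfolded ins]
      \<comment> \<open>A second edge of \<open>T\<close> from \<open>x\<close> to a sink point
        would close a cycle with \<open>{x, s}\<close> through the sink.\<close>
      have "f \<in> E'" if f: "f \<in> T - {?e}" for f
      proof (rule ccontr)
        assume "f \<notin> E'"
        moreover have "card f = 2" "f \<inter> W \<noteq> {}" "f \<in> E" using f TE G by (auto simp: wired_graph_def)
        ultimately obtain t where t: "f = {x, t}" "t \<notin> W"
          by (auto simp: E'_def card_2_iff)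
        have "wconn W (T - {f}) x s" using eT f by (intro wconn_edge) auto
        then have "wconn W (T - {f}) x t" using wconn_outside[OF s t(2)] wconn_trans by metis
        then show False using acy f t by (auto simp: wired_acyclic_def)
      qed
      moreover have "wired_connected (W - {x}) (T - {?e})"
        using con contr by (auto simp: wired_connected_def)
      moreover have "\<not> wconn (W - {x}) (T - {?e} - {{u, v}}) u v" if "{u, v} \<in> T - {?e}" for u v
      proof -
        have "insert ?e (T - {?e} - {{u, v}}) = T - {{u, v}}" using that eT by auto
        then show ?thesis using that acy wconn_contract[OF x s, of "T - {?e} - {{u, v}}"]
          by (simp add: wired_acyclic_def)
      qed
      ultimately show "T - {?e} \<in> wired_trees (W - {x}) E'"
        unfolding wired_trees_def wired_acyclic_def by blast
    qed
  qed
  have "wired_trees W (E - {?e}) = {T \<in> wired_trees W E. ?e \<notin> T}"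
    by (auto simp: wired_trees_def)
  then have "wired_trees W E = wired_trees W (E - {?e}) \<union> {T \<in> wired_trees W E. ?e \<in> T}"
    "wired_trees W (E - {?e}) \<inter> {T \<in> wired_trees W E. ?e \<in> T} = {}" by auto
  then show ?thesis using fin bij_betw_same_card[OF bij] card_Un_disjoint
    by (metis finite_Un)
qed

lemma inner_deg_delete_outer:
  "\<not> e \<subseteq> F \<Longrightarrow> inner_deg (E - {e}) F y = inner_deg E F y"
  unfolding inner_deg_def by (rule arg_cong[where f = card]) auto

lemma finite_allowed_configs:
  assumes G: "wired_graph W E"
  shows "finite (allowed_configs W E)"
proof -
  have finE: "finite E" and finW: "finite W" using G by (auto simp: wired_graph_def)
  have le: "\<eta> y \<le> card E" if "\<eta> \<in> allowed_configs W E" "y \<in> W" for \<eta> y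
  proof -
    have "\<eta> y < edge_deg E y" using that by (simp add: allowed_configs_def)
    also have "\<dots> \<le> card E" unfolding edge_deg_def using finE by (intro card_mono) auto
    finally show ?thesis by simp
  qed
  have "allowed_configs W E \<subseteq> {\<eta>. \<forall>y. (y \<in> W \<longrightarrow> \<eta> y \<in> {..card E}) \<and> (y \<notin> W \<longrightarrow> \<eta> y = 0)}"
    using le by (simp add: subset_iff) (simp add: allowed_configs_def)
  then show ?thesis using finite_set_of_finite_funs[OF finW, of "{..card E}" 0] finite_subset by blast
qed

text \<open>The split is by the height at \<open>x\<close>. A height below the maximum stays stable
  when the degree of \<open>x\<close> drops by one, and deleting an edge to the sink changes no
  inner degree. At maximal height \<open>x\<close> can burn at once through that edge, so it acts as
  a sink point.\<close>

lemma allowed_configs_delete_contract: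
  assumes G: "wired_graph W E" and e: "{x, s} \<in> E" and x: "x \<in> W" and s: "s \<notin> W"
  defines "E' \<equiv> {f \<in> E. f \<inter> (W - {x}) \<noteq> {}}"
  shows "card (allowed_configs W E) =
    card (allowed_configs W (E - {{x, s}})) + card (allowed_configs (W - {x}) E')"
proof -
  let ?e = "{x, s}"
  let ?d = "edge_deg E x"
  have finE: "finite E" and finW: "finite W" using G by (auto simp: wired_graph_def)
  have fin: "finite (allowed_configs W E)" by (rule finite_allowed_configs[OF G])
  have d1: "edge_deg (E - {?e}) x = ?d - 1"
  proof -
    have "{f \<in> E - {?e}. x \<in> f} = {f \<in> E. x \<in> f} - {?e}" by auto
    then show ?thesis using e finE by (simp add: edge_deg_def)
  qed
  have dpos: "?d > 0" unfolding edge_deg_def using e finE by (auto simp: card_gt_0_iff)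
  have dy: "edge_deg (E - {?e}) y = edge_deg E y" if "y \<in> W" "y \<noteq> x" for y
    unfolding edge_deg_def using that s by (intro arg_cong[where f = card]) auto
  have inner: "inner_deg (E - {?e}) F y = inner_deg E F y" if "F \<subseteq> W" for F y
    using that s by (intro inner_deg_delete_outer) auto
  have small: "allowed_configs W (E - {?e}) = {\<eta> \<in> allowed_configs W E. \<eta> x < ?d - 1}" (is "_ = ?S")
  proof -
    have "(\<forall>y\<in>W. \<eta> y < edge_deg (E - {?e}) y) \<longleftrightarrow> (\<forall>y\<in>W. \<eta> y < edge_deg E y) \<and> \<eta> x < ?d - 1" for \<eta>
    proof -
      have "\<eta> y < edge_deg (E - {?e}) y \<longleftrightarrow> (if y = x then \<eta> x < ?d - 1 else \<eta> y < edge_deg E y)"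
        if "y \<in> W" for y
        using that by (cases "y = x") (simp_all add: d1 dy)
      then have "(\<forall>y\<in>W. \<eta> y < edge_deg (E - {?e}) y) \<longleftrightarrow>
          (\<forall>y\<in>W. if y = x then \<eta> x < ?d - 1 else \<eta> y < edge_deg E y)"
        by (rule ball_cong[OF refl])
      also have "\<dots> \<longleftrightarrow> (\<forall>y\<in>W. \<eta> y < edge_deg E y) \<and> \<eta> x < ?d - 1"
        using x less_imp_diff_less[of _ ?d 1] by (metis diff_le_self less_le_trans)
      finally show ?thesis .
    qed
    moreover have "no_forbidden W (E - {?e}) \<eta> \<longleftrightarrow> no_forbidden W E \<eta>" for \<eta>
      by (simp add: no_forbidden_def inner)
    ultimately show ?thesis unfolding allowed_configs_def by auto
  qed
  let ?L = "{\<eta> \<in> allowed_configs W E. \<eta> x = ?d - 1}"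
  have inner': "inner_deg E' F y = inner_deg E F y" if "F \<subseteq> W - {x}" "y \<in> F" for F y
    unfolding inner_deg_def E'_def using that by (intro arg_cong[where f = card]) auto
  have deg': "edge_deg E' y = edge_deg E y" if "y \<in> W - {x}" for y
    unfolding edge_deg_def E'_def using that by (intro arg_cong[where f = card]) auto
  \<comment> \<open>The edge \<open>{x, s}\<close> leaves every \<open>F \<subseteq> W\<close>, so
    maximal height at \<open>x\<close> always suffices to burn it.\<close>
  have xF: "inner_deg E F x \<le> ?d - 1" if "F \<subseteq> W" for F
  proof -
    have "inner_deg (E - {?e}) F x \<le> edge_deg (E - {?e}) x"
      unfolding inner_deg_def edge_deg_def using finE by (intro card_mono) auto
    then show ?thesis using inner[OF that] d1 by simp
  qed
  have bij: "bij_betw (\<lambda>\<eta>. \<eta>(x := 0)) ?L (allowed_configs (W - {x}) E')"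
  proof (rule bij_betw_byWitness[where f' = "\<lambda>\<eta>. \<eta>(x := ?d - 1)"])
    show "\<forall>\<eta>\<in>allowed_configs (W - {x}) E'. (\<eta>(x := ?d - 1))(x := 0) = \<eta>"
      by (auto simp: allowed_configs_def)
    show "(\<lambda>\<eta>. \<eta>(x := 0)) ` ?L \<subseteq> allowed_configs (W - {x}) E'"
    proof safe
      fix \<eta> assume \<eta>: "\<eta> \<in> allowed_configs W E" "\<eta> x = ?d - 1"
      have "no_forbidden (W - {x}) E' (\<eta>(x := 0))"
      proof (rule no_forbiddenI)
        fix F assume F: "F \<subseteq> W - {x}" "F \<noteq> {}"
        moreover have "no_forbidden W E \<eta>" using \<eta> by (simp add: allowed_configs_def)
        ultimately obtain y where "y \<in> F" "inner_deg E F y \<le> \<eta> y"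
          by (elim no_forbiddenE[of W E \<eta> F]) auto
        then show "\<exists>y\<in>F. inner_deg E' F y \<le> (\<eta>(x := 0)) y"
          using F inner'[OF F(1)] by (intro bexI[of _ y]) auto
      qed
      then show "\<eta>(x := 0) \<in> allowed_configs (W - {x}) E'"
        using \<eta> by (simp add: allowed_configs_def deg')
    qed
    show "(\<lambda>\<eta>. \<eta>(x := ?d - 1)) ` allowed_configs (W - {x}) E' \<subseteq> ?L"
    proof safe
      fix \<eta> assume \<eta>: "\<eta> \<in> allowed_configs (W - {x}) E'"
      have "no_forbidden W E (\<eta>(x := ?d - 1))"
      proof (rule no_forbiddenI)
        fix F assume F: "F \<subseteq> W" "F \<noteq> {}"
        show "\<exists>y\<in>F. inner_deg E F y \<le> (\<eta>(x := ?d - 1)) y"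
        proof (cases "x \<in> F")
          case True then show ?thesis using xF[OF F(1)] by (intro bexI[of _ x]) auto
        next
          case False
          then have Fx: "F \<subseteq> W - {x}" using F by auto
          moreover have "no_forbidden (W - {x}) E' \<eta>" using \<eta> by (simp add: allowed_configs_def)
          ultimately obtain y where "y \<in> F" "inner_deg E' F y \<le> \<eta> y"
            using F by (elim no_forbiddenE[of "W - {x}" E' \<eta> F]) auto
          then show ?thesis using False inner'[OF Fx] by (intro bexI[of _ y]) auto
        qed
      qed
      moreover have "\<eta> y < edge_deg E y" if "y \<in> W" "y \<noteq> x" for y
        using that \<eta> by (simp add: allowed_configs_def deg'[symmetric])
      moreover have "\<eta> y = 0" if "y \<notin> W" for y
        using that \<eta> by (auto simp: allowed_configs_def)
      ultimately show "\<eta>(x := ?d - 1) \<in> allowed_configs W E"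
        using dpos x by (simp add: allowed_configs_def)
    qed auto
  qed auto
  have "\<eta> x < ?d - 1 \<or> \<eta> x = ?d - 1" if "\<eta> \<in> allowed_configs W E" for \<eta>
  proof -
    have "\<eta> x < ?d" using that x by (auto simp: allowed_configs_def)
    then show ?thesis by linarith
  qed
  then have "allowed_configs W E = ?S \<union> ?L" by blast
  moreover have "card (?S \<union> ?L) = card ?S + card ?L"
    using fin by (intro card_Un_disjoint) auto
  ultimately have "card (allowed_configs W E) = card ?S + card ?L" by simp
  then show "card (allowed_configs W E) =
    card (allowed_configs W (E - {{x, s}})) + card (allowed_configs (W - {x}) E')"
    using small bij_betw_same_card[OF bij] by simp
qed

text \<open>The recursion stops in two cases. With no vertices there is one empty tree and one zero
  configuration. With vertices but no edge to the sink, nothing can be connected to the sink, and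
  \<open>W\<close> itself is forbidden because stability keeps each height below the degree inside
  \<open>W\<close>; both counts are zero.\<close>

theorem card_allowed_configs_eq_card_wired_trees:
  assumes "wired_graph W E"
  shows "card (allowed_configs W E) = card (wired_trees W E)"
  using assms
proof (induction "card W + card E" arbitrary: W E rule: less_induct)
  case less
  note G = \<open>wired_graph W E\<close>
  have finE: "finite E" and finW: "finite W" using G by (auto simp: wired_graph_def)
  consider "W = {}" | x s where "x \<in> W" "s \<notin> W" "{x, s} \<in> E"
    | "W \<noteq> {}" "\<And>e. e \<in> E \<Longrightarrow> e \<subseteq> W"
  proof (cases "\<exists>e\<in>E. \<not> e \<subseteq> W")
    case True
    then obtain e where "e \<in> E" "\<not> e \<subseteq> W" by auto
    moreover from this G have "card e = 2" "e \<inter> W \<noteq> {}" by (auto simp: wired_graph_def)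
    ultimately show ?thesis using that(2) by (auto simp: card_2_iff) (metis insert_commute)
  qed (use that in blast)
  then show ?case
  proof cases
    case 1
    with G have "E = {}" by (auto simp: wired_graph_def)
    with 1 have "allowed_configs W E = {\<lambda>_. 0}" "wired_trees W E = {{}}"
      by (auto simp: allowed_configs_def no_forbidden_def wired_trees_def wired_connected_def wired_acyclic_def)
    then show ?thesis by simp
  next
    case (2 x s)
    define E' where "E' = {f \<in> E. f \<inter> (W - {x}) \<noteq> {}}"
    have "card (E - {{x, s}}) < card E" using 2 finE by (intro psubset_card_mono) auto
    moreover have "wired_graph W (E - {{x, s}})" using G by (auto simp: wired_graph_def)
    moreover have "card (W - {x}) < card W" using 2 finW by (intro psubset_card_mono) auto
    moreover have "card E' \<le> card E" unfolding E'_def using finE by (intro card_mono) auto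
    moreover have "wired_graph (W - {x}) E'" using G by (auto simp: wired_graph_def E'_def)
    ultimately show ?thesis
      using less.hyps[of W "E - {{x, s}}"] less.hyps[of "W - {x}" E']
        wired_trees_delete_contract[OF G 2(3,1,2)] allowed_configs_delete_contract[OF G 2(3,1,2)]
      by (simp add: E'_def)
  next
    case 3
    have deg: "inner_deg E W x = edge_deg E x" for x
      unfolding inner_deg_def edge_deg_def using 3 by (intro arg_cong[where f = card]) auto
    have "\<eta> \<notin> allowed_configs W E" for \<eta>
    proof
      assume \<eta>: "\<eta> \<in> allowed_configs W E"
      then have "no_forbidden W E \<eta>" by (simp add: allowed_configs_def)
      then obtain x where "x \<in> W" "inner_deg E W x \<le> \<eta> x"
        using \<open>W \<noteq> {}\<close> by (elim no_forbiddenE[of W E \<eta> W]) auto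
      moreover from this(1) have "\<eta> x < edge_deg E x" using \<eta> by (simp add: allowed_configs_def)
      ultimately show False by (simp add: deg)
    qed
    moreover have "T \<notin> wired_trees W E" for T
    proof
      assume T: "T \<in> wired_trees W E"
      obtain x where x: "x \<in> W" using 3 by auto
      then obtain s where "s \<notin> W" "wconn W T x s" using T by (auto simp: wired_trees_def wired_connected_def)
      moreover have "y \<in> W" if "wconn W T x y" for y
        using that by (induction rule: wconn_induct) (use x 3 T in \<open>auto simp: wired_trees_def\<close>)
      ultimately show False by blast
    qed
    ultimately have "allowed_configs W E = {}" "wired_trees W E = {}" by blast+
    then show ?thesis by simp
  qed
qed

section \<open>Removing a finite set with prescribed exits\<close>

lemma wired_graph_subset: "wired_graph W E \<Longrightarrow> E' \<subseteq> E \<Longrightarrow> wired_graph W E'"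
  unfolding wired_graph_def by (auto intro: finite_subset)

text \<open>The rank bound for forests, with the sink as extra vertex. It allows spanning to be
  verified by counting edges instead of constructing paths. The induction contracts an edge to the
  sink as long as there is one.\<close>

lemma card_wired_acyclic:
  assumes "wired_graph W T" "wired_acyclic W T"
  shows "card T \<le> card W \<and> (card T = card W \<longleftrightarrow> wired_connected W T)"
  using assms
proof (induction "card W" arbitrary: W T rule: less_induct)
  case less
  note G = \<open>wired_graph W T\<close> and acy = \<open>wired_acyclic W T\<close>
  have finT: "finite T" and finW: "finite W" using G by (auto simp: wired_graph_def)
  consider "W = {}" | x s where "x \<in> W" "s \<notin> W" "{x, s} \<in> T"
    | "W \<noteq> {}" "\<And>e. e \<in> T \<Longrightarrow> e \<subseteq> W"
  proof (cases "\<exists>e\<in>T. \<not> e \<subseteq> W")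
    case True
    then obtain e where "e \<in> T" "\<not> e \<subseteq> W" by auto
    moreover from this G have "card e = 2" "e \<inter> W \<noteq> {}" by (auto simp: wired_graph_def)
    ultimately show ?thesis using that(2) by (auto simp: card_2_iff) (metis insert_commute)
  qed (use that in blast)
  then show ?case
  proof cases
    case 1
    with G have "T = {}" by (auto simp: wired_graph_def)
    with 1 show ?thesis by (simp add: wired_connected_def)
  next
    case (2 x s)
    let ?S = "T - {{x, s}}"
    have ins: "insert {x, s} ?S = T" using 2 by auto
    have xs: "wconn W T x s" using 2 by (intro wconn_edge)
    note contr = wconn_contract[OF 2(1,2), of ?S, unfolded ins]
    have cT: "card T = Suc (card ?S)" and cW: "card W = Suc (card (W - {x}))"
      using 2 finT finW by (metis card.remove)+
    have meets: "f \<inter> (W - {x}) \<noteq> {}" if f: "f \<in> ?S" for f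
    proof
      assume "f \<inter> (W - {x}) = {}"
      moreover have "card f = 2" "f \<inter> W \<noteq> {}" using f G by (auto simp: wired_graph_def)
      ultimately obtain t where t: "f = {x, t}" "t \<notin> W"
        by (auto simp: card_2_iff)
      have "wconn W (T - {f}) x s" using 2 f by (intro wconn_edge) auto
      then have "wconn W (T - {f}) x t" using wconn_outside[OF 2(2) t(2)] by (rule wconn_trans)
      then show False using acy f t by (auto simp: wired_acyclic_def)
    qed
    then have "wired_graph (W - {x}) ?S" using G by (auto simp: wired_graph_def)
    moreover have "wired_acyclic (W - {x}) ?S"
      unfolding wired_acyclic_def
    proof (intro allI impI)
      fix u v assume uv: "{u, v} \<in> ?S"
      have "insert {x, s} (?S - {{u, v}}) = T - {{u, v}}" using uv 2 by auto
      then show "\<not> wconn (W - {x}) (?S - {{u, v}}) u v"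
        using uv acy wconn_contract[OF 2(1,2), of "?S - {{u, v}}"] by (simp add: wired_acyclic_def)
    qed
    moreover have "card (W - {x}) < card W" using cW by simp
    ultimately have IH: "card ?S \<le> card (W - {x}) \<and>
        (card ?S = card (W - {x}) \<longleftrightarrow> wired_connected (W - {x}) ?S)"
      using less.hyps by blast
    have "wired_connected (W - {x}) ?S \<longleftrightarrow> wired_connected W T"
    proof
      assume con: "wired_connected (W - {x}) ?S"
      show "wired_connected W T"
        unfolding wired_connected_def
      proof
        fix y assume y: "y \<in> W"
        show "\<exists>s. s \<notin> W \<and> wconn W T y s"
        proof (cases "y = x")
          case True then show ?thesis using xs 2 by blast
        next
          case False
          then obtain t where "t \<notin> W - {x}" "wconn W T y t"
            using con y unfolding wired_connected_def contr by blast
          then show ?thesis using 2 wconn_trans[OF _ xs] by (cases "t = x") blast+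
        qed
      qed
    next
      assume "wired_connected W T"
      then show "wired_connected (W - {x}) ?S" unfolding wired_connected_def contr by blast
    qed
    then show ?thesis using IH cT cW by simp
  next
    case 3
    \<comment> \<open>Without an edge to the sink, any vertex \<open>x\<close> can be made a sink
      point without creating a cycle, so the forest has fewer than \<open>card W\<close>
      edges.\<close>
    obtain x where x: "x \<in> W" using 3 by auto
    have "f \<inter> (W - {x}) \<noteq> {}" if f: "f \<in> T" for f
    proof -
      have "card f = 2" "f \<subseteq> W" using f G 3 by (auto simp: wired_graph_def)
      then show ?thesis by (auto simp: card_2_iff)
    qed
    then have "wired_graph (W - {x}) T" using G by (auto simp: wired_graph_def)
    moreover have "wired_acyclic (W - {x}) T"
      unfolding wired_acyclic_def
    proof (intro allI impI notI)
      fix u v assume uv: "{u, v} \<in> T" and c: "wconn (W - {x}) (T - {{u, v}}) u v"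
      define S where "S = T - {{u, v}}"
      have in_W: "u \<in> W" "v \<in> W" using 3(2)[OF uv] by auto
      \<comment> \<open>No edge meets the old sink points, so a walk that jumps to them can only
        come back at \<open>x\<close>; the invariant replaces them by \<open>x\<close>.\<close>
      have "(w \<in> W \<longrightarrow> wconn W S u w) \<and> (w \<notin> W \<longrightarrow> wconn W S u x)"
        if "wconn (W - {x}) S u w" for w
        using that
      proof (induction rule: wconn_induct)
        case (edge y z)
        then have "y \<in> W" "z \<in> W" using 3(2) by (auto simp: S_def)
        moreover have "wconn W S y z" using edge by (intro wconn_edge)
        moreover have "wconn W S u y" using edge \<open>y \<in> W\<close> by simp
        ultimately show ?case using wconn_trans[of W S u y z] by simp
      next
        case (outside y z)
        then show ?case by auto
      qed (use in_W in auto)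
      from this[of v] have "wconn W S u v" using c in_W by (simp add: S_def)
      then show False using acy uv by (auto simp: wired_acyclic_def S_def)
    qed
    moreover have cW: "card W = Suc (card (W - {x}))"
      using x finW by (metis card.remove)
    ultimately have "card T < card W" using less.hyps[of "W - {x}" T] by simp
    moreover have "\<not> wired_connected W T"
    proof
      assume "wired_connected W T"
      then obtain s where "s \<notin> W" "wconn W T x s" using x by (auto simp: wired_connected_def)
      moreover have "y \<in> W" if "wconn W T x y" for y
        using that by (induction rule: wconn_induct) (use x 3 in auto)
      ultimately show False by blast
    qed
    ultimately show ?thesis by simp
  qed
qed


text \<open>No edge of \<open>S\<close> meets \<open>D\<close>, so a walk gets into \<open>D\<close>
  only through an identification with the sink of \<open>W\<close>. Adding \<open>D\<close> to the
  sink thus creates no new connections among the other vertices.\<close>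

lemma wconn_avoiding:
  assumes "wconn (W - D) S u v" and u: "u \<notin> D" and D: "D \<subseteq> W"
    and S: "\<And>e. e \<in> S \<Longrightarrow> e \<inter> D = {}"
  shows "if v \<in> D then \<exists>s. s \<notin> W \<and> wconn W S u s else wconn W S u v"
  using assms(1)
proof (induction rule: wconn_induct)
  case (edge y z)
  then have "y \<notin> D" "z \<notin> D" using S by blast+
  moreover have "wconn W S y z" using edge by (intro wconn_edge)
  moreover have "wconn W S u y" using edge \<open>y \<notin> D\<close> by simp
  ultimately show ?case using wconn_trans[of W S u y z] by simp
next
  case (outside y z)
  then have y: "y \<in> D \<or> y \<notin> W" and z: "z \<in> D \<or> z \<notin> W" by auto
  obtain s where s: "s \<notin> W" "wconn W S u s" using outside.IH y by (cases "y \<in> D") auto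
  show ?case
  proof (cases "z \<in> D")
    case False
    then have "wconn W S s z" using s z by (intro wconn_outside) auto
    then show ?thesis using s False wconn_trans[of W S u s z] by simp
  qed (use s in auto)
qed (use u in simp)

text \<open>The edges at D from which those joining D - K to the complement of D have been deleted.
A spanning tree T of the wired graph induces a spanning tree of D with these edges exactly if
D consists of K and the descendants of K in T (rooted at the sink).\<close>

definition exit_edges :: "'a set set \<Rightarrow> 'a set \<Rightarrow> 'a set \<Rightarrow> 'a set set" where
  "exit_edges E K D = {e \<in> E. e \<inter> D \<noteq> {} \<and> (e \<subseteq> D \<or> e \<inter> K \<noteq> {})}"

definition touching :: "'a set set \<Rightarrow> 'a set \<Rightarrow> 'a set set" where
  "touching E D = {e \<in> E. e \<inter> D \<noteq> {}}"

lemma wired_graph_exit_edges: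
  "wired_graph W E \<Longrightarrow> D \<subseteq> W \<Longrightarrow> wired_graph D (exit_edges E K D)"
  by (auto simp: wired_graph_def exit_edges_def intro: finite_subset)

lemma wired_graph_remove:
  "wired_graph W E \<Longrightarrow> wired_graph (W - D) (E - touching E D)"
  by (auto simp: wired_graph_def touching_def)

text \<open>That the outer part still spans follows by counting: \<open>T\<close> has
  \<open>card W\<close> edges and its part at \<open>D\<close> has \<open>card D\<close>, so the
  acyclic rest has \<open>card (W - D)\<close> edges and must span.\<close>

lemma wired_trees_remove:
  assumes G: "wired_graph W E" and D: "D \<subseteq> W" and T: "T \<in> wired_trees W E"
    and TD: "T \<inter> touching E D \<in> wired_trees D (exit_edges E K D)"
  shows "T - touching E D \<in> wired_trees (W - D) (E - touching E D)"
proof -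
  let ?A = "T \<inter> touching E D" and ?B = "T - touching E D"
  have TE: "T \<subseteq> E" and acyT: "wired_acyclic W T" and conT: "wired_connected W T"
    using T by (auto simp: wired_trees_def)
  have fin: "finite W" "finite T" using G TE by (auto simp: wired_graph_def intro: finite_subset)
  have avoid: "e \<inter> D = {}" if "e \<in> ?B" for e using that TE by (auto simp: touching_def)
  have acy: "wired_acyclic (W - D) ?B"
    unfolding wired_acyclic_def
  proof (intro allI impI notI)
    fix u v assume uv: "{u, v} \<in> ?B" and c: "wconn (W - D) (?B - {{u, v}}) u v"
    have "u \<notin> D" "v \<notin> D" using avoid[OF uv] by auto
    then have "wconn W (?B - {{u, v}}) u v"
      using wconn_avoiding[OF c _ D] avoid by auto
    then have "wconn W (T - {{u, v}}) u v" by (rule wconn_mono) auto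
    then show False using acyT uv by (auto simp: wired_acyclic_def)
  qed
  have "wired_graph W T" using G TE by (rule wired_graph_subset)
  then have "card T = card W" using card_wired_acyclic acyT conT by blast
  moreover have "card ?A = card D"
  proof -
    have "wired_graph D ?A"
      using wired_graph_exit_edges[OF G D] by (rule wired_graph_subset) (use TD in \<open>auto simp: wired_trees_def\<close>)
    then show ?thesis using card_wired_acyclic TD unfolding wired_trees_def by blast
  qed
  moreover have "card T = card ?A + card ?B" using fin by (metis card_Int_Diff)
  moreover have "card W = card D + card (W - D)"
    using fin D by (metis card_Diff_subset card_mono finite_subset le_add_diff_inverse)
  ultimately have "card ?B = card (W - D)" by linarith
  moreover have gB: "wired_graph (W - D) ?B"
    using wired_graph_remove[OF G] by (rule wired_graph_subset) (use TE in auto)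
  ultimately have "wired_connected (W - D) ?B" using card_wired_acyclic acy by blast
  then show ?thesis using acy TE by (auto simp: wired_trees_def)
qed

lemma finite_wired_trees: "wired_graph W E \<Longrightarrow> finite (wired_trees W E)"
  by (rule finite_subset[of _ "Pow E"]) (auto simp: wired_trees_def wired_graph_def)

text \<open>A tree is recovered from its edges at \<open>D\<close> and the remaining ones. An upper
  bound is the direction that makes tree probabilities minorants of sandpile probabilities.\<close>

lemma card_wired_trees_exit_le:
  assumes G: "wired_graph W E" and D: "D \<subseteq> W"
  shows "card {T \<in> wired_trees W E. T \<inter> touching E D \<in> wired_trees D (exit_edges E K D)}
    \<le> card (wired_trees D (exit_edges E K D)) * card (wired_trees (W - D) (E - touching E D))"
    (is "card ?L \<le> card ?A * card ?B")
proof -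
  have fin: "finite ?A" "finite ?B"
    using finite_wired_trees wired_graph_exit_edges[OF G D] wired_graph_remove[OF G] by blast+
  have "inj_on (\<lambda>T. (T \<inter> touching E D, T - touching E D)) ?L"
    by (rule inj_onI) (metis Int_Diff_Un prod.inject)
  moreover have "(\<lambda>T. (T \<inter> touching E D, T - touching E D)) ` ?L \<subseteq> ?A \<times> ?B"
    using wired_trees_remove[OF G D] by auto
  ultimately have "card ?L \<le> card (?A \<times> ?B)"
    using fin by (intro card_inj_on_le) auto
  then show ?thesis by (simp add: card_cartesian_product)
qed

section \<open>Gluing an inner and an outer configuration\<close>

definition glue_config ::
  "'a set set \<Rightarrow> 'a set \<Rightarrow> 'a set \<Rightarrow> ('a \<Rightarrow> nat) \<Rightarrow> ('a \<Rightarrow> nat) \<Rightarrow> 'a \<Rightarrow> nat" where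
  "glue_config E W D \<zeta> \<rho> =
     (\<lambda>x. if x \<in> D then \<zeta> x else if x \<in> W then \<rho> x + edge_deg (touching E D) x else 0)"

lemma edge_deg_split:
  "finite E \<Longrightarrow> edge_deg E x = edge_deg (E - touching E D) x + edge_deg (touching E D) x"
  unfolding edge_deg_def touching_def
  by (subst card_Un_disjoint[symmetric]) (auto intro!: arg_cong[where f = card])

text \<open>The origin of the shift in \<open>glue_config\<close>: as long as \<open>D\<close> is
  unburnt, a vertex outside \<open>D\<close> needs one extra unit of height for each of its edges
  into \<open>D\<close>.\<close>

lemma inner_deg_Un:
  assumes G: "wired_graph W E" and "x \<in> F" "F \<inter> D = {}"
  shows "inner_deg E (F \<union> D) x = inner_deg (E - touching E D) F x + edge_deg (touching E D) x"
proof -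
  have "e \<subseteq> F \<union> D" if "e \<in> touching E D" "x \<in> e" for e
  proof -
    have "card e = 2" "e \<inter> D \<noteq> {}" using that G by (auto simp: touching_def wired_graph_def)
    then show ?thesis using assms(2,3) that by (auto simp: card_2_iff)
  qed
  then have "{e \<in> E. x \<in> e \<and> e \<subseteq> F \<union> D} =
      {e \<in> E - touching E D. x \<in> e \<and> e \<subseteq> F} \<union> {e \<in> touching E D. x \<in> e}"
    by (auto simp: touching_def)
  moreover have "finite E" using G by (simp add: wired_graph_def)
  ultimately show ?thesis unfolding inner_deg_def edge_deg_def
    by (simp add: card_Un_disjoint touching_def disjoint_iff)
qed

lemma inner_deg_mono: "finite E \<Longrightarrow> F \<subseteq> F' \<Longrightarrow> inner_deg E F x \<le> inner_deg E F' x"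
  unfolding inner_deg_def by (rule card_mono) auto

lemma edge_deg_mono: "finite E \<Longrightarrow> E' \<subseteq> E \<Longrightarrow> edge_deg E' x \<le> edge_deg E x"
  unfolding edge_deg_def by (rule card_mono) auto

text \<open>Even while all of \<open>D\<close> is kept unburnt, the rest of \<open>W\<close> burns
  completely, just as \<rho> does in the graph without \<open>D\<close>.\<close>

lemma glue_config_outside:
  assumes G: "wired_graph W E" and \<rho>: "\<rho> \<in> allowed_configs (W - D) (E - touching E D)"
    and F: "F \<subseteq> W - D" "F \<noteq> {}"
  shows "\<exists>x\<in>F. inner_deg E (F \<union> D) x \<le> glue_config E W D \<zeta> \<rho> x"
proof -
  have "no_forbidden (W - D) (E - touching E D) \<rho>" using \<rho> by (simp add: allowed_configs_def)
  then obtain x where x: "x \<in> F" "inner_deg (E - touching E D) F x \<le> \<rho> x"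
    using F by (rule no_forbiddenE)
  moreover have "F \<inter> D = {}" "x \<in> W - D" using F x by auto
  ultimately show ?thesis
    using inner_deg_Un[OF G x(1)] by (intro bexI[of _ x]) (auto simp: glue_config_def)
qed

text \<open>Vertices of \<open>D - K\<close> have no exits in \<open>exit_edges E K D\<close>, so
  their stability there says exactly that they cannot burn while \<open>D\<close> is
  unburnt.\<close>

lemma glue_config_inside:
  assumes G: "wired_graph W E" and \<zeta>: "\<zeta> \<in> allowed_configs D (exit_edges E K D)"
    and K: "K \<subseteq> D" and x: "x \<in> D - K"
  shows "glue_config E W D \<zeta> \<rho> x < inner_deg E D x"
proof -
  have "e \<subseteq> D" if "e \<in> exit_edges E K D" "x \<in> e" for e
  proof (cases "e \<inter> K = {}")
    case False
    have "card e = 2" using that G by (auto simp: exit_edges_def wired_graph_def)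
    then show ?thesis using False that x K by (auto simp: card_2_iff)
  qed (use that in \<open>auto simp: exit_edges_def\<close>)
  then have "edge_deg (exit_edges E K D) x = inner_deg E D x"
    unfolding edge_deg_def inner_deg_def using x
    by (intro arg_cong[where f = card]) (auto simp: exit_edges_def)
  then show ?thesis using \<zeta> x by (auto simp: glue_config_def allowed_configs_def)
qed

lemma glue_config_allowed:
  assumes G: "wired_graph W E" and D: "D \<subseteq> W"
    and \<zeta>: "\<zeta> \<in> allowed_configs D (exit_edges E K D)"
    and \<rho>: "\<rho> \<in> allowed_configs (W - D) (E - touching E D)"
  shows "glue_config E W D \<zeta> \<rho> \<in> allowed_configs W E"
proof -
  let ?\<eta> = "glue_config E W D \<zeta> \<rho>"
  have finE: "finite E" using G by (simp add: wired_graph_def)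
  have "?\<eta> x < edge_deg E x" if "x \<in> W" for x
  proof (cases "x \<in> D")
    case True
    then have "?\<eta> x < edge_deg (exit_edges E K D) x"
      using \<zeta> by (simp add: glue_config_def allowed_configs_def)
    also have "\<dots> \<le> edge_deg E x" using finE by (rule edge_deg_mono) (auto simp: exit_edges_def)
    finally show ?thesis .
  next
    case False
    then have "\<rho> x < edge_deg (E - touching E D) x" using \<rho> that by (simp add: allowed_configs_def)
    then show ?thesis using edge_deg_split[OF finE, of x D] False that by (simp add: glue_config_def)
  qed
  moreover have "no_forbidden W E ?\<eta>"
  proof (rule no_forbiddenI)
    fix F assume F: "F \<subseteq> W" "F \<noteq> {}"
    show "\<exists>x\<in>F. inner_deg E F x \<le> ?\<eta> x"
    \<comment> \<open>A set inside \<open>D\<close> is handled by \<zeta>; any other one contains a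
      vertex outside \<open>D\<close> that burns even with all of \<open>D\<close> added to the
      set.\<close>
    proof (cases "F \<subseteq> D")
      case True
      have "no_forbidden D (exit_edges E K D) \<zeta>" using \<zeta> by (simp add: allowed_configs_def)
      then obtain x where x: "x \<in> F" "inner_deg (exit_edges E K D) F x \<le> \<zeta> x"
        using True F(2) by (rule no_forbiddenE)
      moreover have "inner_deg (exit_edges E K D) F x = inner_deg E F x"
        unfolding inner_deg_def using True x(1)
        by (intro arg_cong[where f = card]) (auto simp: exit_edges_def)
      ultimately show ?thesis using True by (intro bexI[of _ x]) (auto simp: glue_config_def)
    next
      case False
      then obtain x where x: "x \<in> F - D" "inner_deg E (F - D \<union> D) x \<le> ?\<eta> x"
        using glue_config_outside[OF G \<rho>, of "F - D" \<zeta>] F by auto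
      moreover have "inner_deg E F x \<le> inner_deg E (F - D \<union> D) x"
        using finE by (rule inner_deg_mono) auto
      ultimately show ?thesis by (intro bexI[of _ x]) auto
    qed
  qed
  moreover have "?\<eta> x = 0" if "x \<notin> W" for x using that D by (auto simp: glue_config_def)
  ultimately show ?thesis by (simp add: allowed_configs_def)
qed

text \<open>The set D can be read off the glued configuration: it is what remains unburnt
when the vertices of K are not allowed to topple.\<close>

lemma glue_config_subset:
  assumes G: "wired_graph W E" and D: "K \<subseteq> D" and D': "K \<subseteq> D'" "D' \<subseteq> W"
    and \<rho>: "\<rho> \<in> allowed_configs (W - D) (E - touching E D)"
    and \<zeta>': "\<zeta>' \<in> allowed_configs D' (exit_edges E K D')"
    and eq: "glue_config E W D \<zeta> \<rho> = glue_config E W D' \<zeta>' \<rho>'"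
  shows "D' \<subseteq> D"
proof (rule ccontr)
  assume "\<not> D' \<subseteq> D"
  then have "D' - D \<subseteq> W - D" "D' - D \<noteq> {}" using D' by auto
  then obtain x where x: "x \<in> D' - D" "inner_deg E (D' - D \<union> D) x \<le> glue_config E W D \<zeta> \<rho> x"
    using glue_config_outside[OF G \<rho>] by blast
  have "inner_deg E D' x \<le> inner_deg E (D' - D \<union> D) x"
    using G by (intro inner_deg_mono) (auto simp: wired_graph_def)
  moreover have "glue_config E W D' \<zeta>' \<rho>' x < inner_deg E D' x"
    using glue_config_inside[OF G \<zeta>' D'(1)] x D by auto
  ultimately show False using x eq by simp
qed

lemma glue_config_inj:
  assumes "D \<subseteq> W" and \<zeta>: "\<zeta> \<in> allowed_configs D H" "\<zeta>' \<in> allowed_configs D H"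
    and \<rho>: "\<rho> \<in> allowed_configs (W - D) B" "\<rho>' \<in> allowed_configs (W - D) B"
    and eq: "glue_config E W D \<zeta> \<rho> = glue_config E W D \<zeta>' \<rho>'"
  shows "\<zeta> = \<zeta>' \<and> \<rho> = \<rho>'"
proof (intro conjI ext)
  fix x
  show "\<zeta> x = \<zeta>' x"
    using fun_cong[OF eq, of x] \<zeta> by (cases "x \<in> D") (auto simp: glue_config_def allowed_configs_def)
  show "\<rho> x = \<rho>' x"
    using fun_cong[OF eq, of x] \<rho> by (cases "x \<in> W - D") (auto simp: glue_config_def allowed_configs_def)
qed

text \<open>For fixed \<open>D\<close> gluing is injective, and different \<open>D\<close> have
  disjoint images because the glued configuration determines \<open>D\<close>. As
  \<open>K \<subseteq> D\<close>, gluing preserves the heights on \<open>K\<close>.\<close>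

lemma sum_card_allowed_configs_le:
  assumes G: "wired_graph W E" and fin: "finite \<D>" and \<D>: "\<And>D. D \<in> \<D> \<Longrightarrow> K \<subseteq> D \<and> D \<subseteq> W"
  shows "(\<Sum>D\<in>\<D>. card {\<zeta> \<in> allowed_configs D (exit_edges E K D). \<forall>x\<in>K. \<zeta> x = \<xi> x} *
      card (allowed_configs (W - D) (E - touching E D)))
    \<le> card {\<eta> \<in> allowed_configs W E. \<forall>x\<in>K. \<eta> x = \<xi> x}" (is "_ \<le> card ?R")
proof -
  let ?A = "\<lambda>D. {\<zeta> \<in> allowed_configs D (exit_edges E K D). \<forall>x\<in>K. \<zeta> x = \<xi> x}"
  let ?B = "\<lambda>D. allowed_configs (W - D) (E - touching E D)"
  let ?X = "\<lambda>D. (\<lambda>(\<zeta>, \<rho>). glue_config E W D \<zeta> \<rho>) ` (?A D \<times> ?B D)"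
  have finX: "finite (?X D)" if "D \<in> \<D>" for D
    using finite_allowed_configs[OF wired_graph_exit_edges[OF G, of D K]]
      finite_allowed_configs[OF wired_graph_remove[OF G, of D]] \<D>[OF that] by auto
  have "inj_on (\<lambda>(\<zeta>, \<rho>). glue_config E W D \<zeta> \<rho>) (?A D \<times> ?B D)" if "D \<in> \<D>" for D
    using glue_config_inj[of D W] \<D>[OF that] by (auto simp: inj_on_def)
  then have card_X: "card (?X D) = card (?A D) * card (?B D)" if "D \<in> \<D>" for D
    using that by (simp add: card_image card_cartesian_product)
  have "?X D \<inter> ?X D' = {}" if "D \<in> \<D>" "D' \<in> \<D>" "D \<noteq> D'" for D D'
  proof (rule ccontr)
    assume "?X D \<inter> ?X D' \<noteq> {}"
    then obtain \<zeta> \<rho> \<zeta>' \<rho>' where "\<zeta> \<in> ?A D" "\<rho> \<in> ?B D" "\<zeta>' \<in> ?A D'" "\<rho>' \<in> ?B D'"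
      and eq: "glue_config E W D \<zeta> \<rho> = glue_config E W D' \<zeta>' \<rho>'" by auto
    then have "D' \<subseteq> D" "D \<subseteq> D'"
      using glue_config_subset[OF G _ _ _ _ _ eq, of K] glue_config_subset[OF G _ _ _ _ _ eq[symmetric], of K]
        \<D> that by simp_all
    then show False using that by simp
  qed
  then have "card (\<Union>D\<in>\<D>. ?X D) = (\<Sum>D\<in>\<D>. card (?X D))"
    using fin finX by (intro card_UN_disjoint) auto
  then have "(\<Sum>D\<in>\<D>. card (?A D) * card (?B D)) = card (\<Union>D\<in>\<D>. ?X D)"
    using card_X by simp
  also have "\<dots> \<le> card ?R"
  proof (rule card_mono)
    show "finite ?R" using finite_allowed_configs[OF G] by simp
    show "(\<Union>D\<in>\<D>. ?X D) \<subseteq> ?R"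
    proof safe
      fix D \<zeta> \<rho> assume D: "D \<in> \<D>" and \<zeta>: "\<zeta> \<in> allowed_configs D (exit_edges E K D)"
        and \<xi>: "\<forall>x\<in>K. \<zeta> x = \<xi> x" and \<rho>: "\<rho> \<in> ?B D"
      show "glue_config E W D \<zeta> \<rho> \<in> allowed_configs W E"
        using glue_config_allowed[OF G _ \<zeta> \<rho>] \<D>[OF D] by simp
      show "glue_config E W D \<zeta> \<rho> x = \<xi> x" if "x \<in> K" for x
        using that \<xi> \<D>[OF D] by (auto simp: glue_config_def)
    qed
  qed
  finally show ?thesis .
qed

section \<open>Recurrent configurations\<close>

locale sandpile_graph =
  fixes V :: "'a set" and adj :: "'a \<Rightarrow> 'a \<Rightarrow> bool"
  assumes simple: "simple_graph V adj" and inf: "infinite V"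
    and conn: "graph_connected V adj" and lf: "locally_finite V adj"
begin

lemma adj_sym: "adj x y \<longleftrightarrow> adj y x" and adj_irrefl: "\<not> adj x x"
  and adj_V: "adj x y \<Longrightarrow> x \<in> V \<and> y \<in> V"
  using simple by (auto simp: simple_graph_def)

lemma finite_nbrs [simp]: "finite {y. adj x y}"
proof (cases "x \<in> V")
  case False
  then have "{y. adj x y} = {}" using adj_V by blast
  then show ?thesis by simp
qed (use lf in \<open>simp add: locally_finite_def\<close>)

text \<open>Every finite nonempty set leaks. This is the source of dissipation: it excludes endless
  toppling and makes the configuration of maximal heights burn.\<close>

lemma exists_exit:
  assumes "finite F" "F \<noteq> {}" "F \<subseteq> V"
  shows "\<exists>x\<in>F. \<exists>y. adj x y \<and> y \<notin> F"
proof (rule ccontr)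
  assume closed: "\<not> ?thesis"
  obtain x where x: "x \<in> F" using assms by auto
  have "y \<in> F" if "adj\<^sup>*\<^sup>* x y" for y
    using that by (induction rule: rtranclp_induct) (use x closed in blast)+
  then have "V \<subseteq> F" using conn x assms(3) by (auto simp: graph_connected_def)
  then show False using assms(1) inf finite_subset by blast
qed

definition nbr_deg :: "'a set \<Rightarrow> 'a \<Rightarrow> nat" where
  "nbr_deg F x = card {y \<in> F. adj x y}"

lemma nbr_deg_le: "nbr_deg F x \<le> deg adj x"
  unfolding nbr_deg_def deg_def by (rule card_mono) auto

lemma nbr_deg_eq_deg: "nbr_deg F x = deg adj x \<Longrightarrow> adj x y \<Longrightarrow> y \<in> F"
  using card_subset_eq[of "{y. adj x y}" "{y \<in> F. adj x y}"] unfolding nbr_deg_def deg_def by auto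

lemma deg_pos: "x \<in> V \<Longrightarrow> deg adj x > 0"
  using exists_exit[of "{x}"] by (auto simp: deg_def card_gt_0_iff)

lemma wired_edges_at: "{e \<in> wired_edges adj W. x \<in> e} = (\<lambda>y. {x, y}) ` {y. adj x y}" if "x \<in> W"
  using that adj_sym by (auto simp: wired_edges_def edges_def insert_commute)

lemma edge_deg_wired_edges:
  assumes "x \<in> W"
  shows "edge_deg (wired_edges adj W) x = deg adj x"
  unfolding edge_deg_def deg_def wired_edges_at[OF assms]
  by (rule card_image) (auto simp: inj_on_def doubleton_eq_iff)

lemma inner_deg_wired_edges:
  assumes "F \<subseteq> W" "x \<in> F"
  shows "inner_deg (wired_edges adj W) F x = nbr_deg F x"
proof -
  have "x \<in> W" using assms by auto
  then have "{e \<in> wired_edges adj W. x \<in> e \<and> e \<subseteq> F} = (\<lambda>y. {x, y}) ` {y \<in> F. adj x y}"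
    using wired_edges_at[of x W] assms(2) by blast
  then show ?thesis unfolding inner_deg_def nbr_deg_def
    by (simp add: card_image inj_on_def doubleton_eq_iff)
qed

lemma wired_graph_wired_edges:
  assumes "finite W"
  shows "wired_graph W (wired_edges adj W)"
proof -
  have "wired_edges adj W = (\<Union>x\<in>W. {e \<in> wired_edges adj W. x \<in> e})"
    by (auto simp: wired_edges_def)
  also have "\<dots> = (\<Union>x\<in>W. (\<lambda>y. {x, y}) ` {y. adj x y})"
    using wired_edges_at by simp
  finally have "finite (wired_edges adj W)" using assms by simp
  moreover have "card e = 2" if "e \<in> wired_edges adj W" for e
    using that adj_irrefl by (auto simp: wired_edges_def edges_def card_2_iff)
  ultimately show ?thesis using assms by (auto simp: wired_graph_def wired_edges_def)
qed

end

section \<open>Topplings and the maximum principle in a finite volume\<close>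

locale finite_sandpile = sandpile_graph +
  fixes W :: "'a set"
  assumes finW: "finite W" and WV: "W \<subseteq> V"
begin

abbreviation E :: "'a set set" where "E \<equiv> wired_edges adj W"
abbreviation A :: "('a \<Rightarrow> nat) set" where "A \<equiv> allowed_configs W E"

lemma finite_A: "finite A"
  using wired_graph_wired_edges[OF finW] by (rule finite_allowed_configs)

lemma A_iff: "\<eta> \<in> A \<longleftrightarrow> \<eta> \<in> stable_configs adj W \<and> no_forbidden W E \<eta>"
  by (auto simp: allowed_configs_def stable_configs_def stable_def edge_deg_wired_edges)

lemma no_forbidden_nbr:
  assumes "no_forbidden W E \<eta>" "F \<subseteq> W" "F \<noteq> {}"
  obtains x where "x \<in> F" "nbr_deg F x \<le> \<eta> x"
proof -
  obtain x where "x \<in> F" "inner_deg E F x \<le> \<eta> x"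
    using assms by (rule no_forbiddenE)
  then show thesis using that inner_deg_wired_edges[OF assms(2)] by auto
qed

lemma no_forbidden_nbrI:
  assumes "\<And>F. F \<subseteq> W \<Longrightarrow> F \<noteq> {} \<Longrightarrow> \<exists>x\<in>F. nbr_deg F x \<le> \<eta> x"
  shows "no_forbidden W E \<eta>"
proof (rule no_forbiddenI)
  fix F assume F: "F \<subseteq> W" "F \<noteq> {}"
  obtain x where "x \<in> F" "nbr_deg F x \<le> \<eta> x" using assms[OF F] by auto
  then show "\<exists>x\<in>F. inner_deg E F x \<le> \<eta> x" using inner_deg_wired_edges[OF F(1)] by auto
qed

text \<open>Legality of the topplings is ignored here, and n may be negative.\<close>

definition toppled :: "('a \<Rightarrow> nat) \<Rightarrow> ('a \<Rightarrow> int) \<Rightarrow> ('a \<Rightarrow> nat) \<Rightarrow> bool" where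
  "toppled \<eta> n \<zeta> \<longleftrightarrow> (\<forall>x\<in>W. int (\<zeta> x) =
     int (\<eta> x) - int (deg adj x) * n x + (\<Sum>y\<in>{y \<in> W. adj x y}. n y))"

lemma toppled_add: "toppled \<eta> n \<zeta> \<Longrightarrow> toppled \<zeta> m \<xi> \<Longrightarrow> toppled \<eta> (\<lambda>x. n x + m x) \<xi>"
  unfolding toppled_def by (intro ballI) (drule bspec, assumption, drule bspec, assumption, simp add: sum.distrib algebra_simps)

lemma toppled_uminus: "toppled \<eta> n \<zeta> \<Longrightarrow> toppled \<zeta> (\<lambda>x. - n x) \<eta>"
  by (simp add: toppled_def sum_negf)

text \<open>A maximum principle. Let \<open>F\<close> be the set where \<open>n\<close> attains its
  maximum \<open>M\<close>: a vertex of \<open>F\<close> loses \<open>M\<close> grains along each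
  edge and regains at most \<open>M\<close> from neighbours in \<open>F\<close> and
  \<open>M - 1\<close> from all others, so it loses at least one grain per edge leaving
  \<open>F\<close>.\<close>

lemma toppled_maximum:
  assumes t: "toppled \<eta> n \<zeta>" and pos: "\<exists>x\<in>W. n x \<ge> 1"
  obtains F where "F \<subseteq> W" "F \<noteq> {}" "\<And>x. x \<in> F \<Longrightarrow> \<zeta> x + deg adj x \<le> \<eta> x + nbr_deg F x"
proof
  define M where "M = Max (n ` W)"
  define F where "F = {x \<in> W. n x = M}"
  have le: "n x \<le> M" if "x \<in> W" for x using that finW by (simp add: M_def)
  have M1: "M \<ge> 1" using pos le by force
  have "W \<noteq> {}" using pos by auto
  then have "M \<in> n ` W" unfolding M_def using finW by (intro Max_in) auto
  then show "F \<noteq> {}" by (auto simp: F_def)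
  show "F \<subseteq> W" by (auto simp: F_def)
  show "\<zeta> x + deg adj x \<le> \<eta> x + nbr_deg F x" if x: "x \<in> F" for x
  proof -
    let ?S = "{y \<in> W. adj x y}"
    have finS: "finite ?S" using finW by auto
    have "?S \<inter> F = {y \<in> F. adj x y}" by (auto simp: F_def)
    then have "card ?S = nbr_deg F x + card (?S - F)"
      using card_Int_Diff[OF finS, of F] by (simp add: nbr_deg_def)
    moreover have "card ?S \<le> deg adj x"
      using nbr_deg_le[of W x] by (simp add: nbr_deg_def)
    moreover have "(\<Sum>y\<in>?S. n y) \<le> (\<Sum>y\<in>?S. M - (if y \<in> F then 0 else 1))"
    proof (rule sum_mono)
      fix y assume "y \<in> ?S"
      then show "n y \<le> M - (if y \<in> F then 0 else 1)"
        using le[of y] by (auto simp: F_def)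
    qed
    moreover have "(\<Sum>y\<in>?S. M - (if y \<in> F then 0 else 1)) = M * int (card ?S) - int (card (?S - F))"
    proof -
      have "(\<Sum>y\<in>?S. if y \<in> F then 0 else 1 :: int) = (\<Sum>y\<in>?S - F. 1)"
        using finS by (intro sum.mono_neutral_cong_right) auto
      then show ?thesis by (simp add: sum_subtractf)
    qed
    moreover have "int (\<zeta> x) = int (\<eta> x) - int (deg adj x) * M + (\<Sum>y\<in>?S. n y)"
      using t x by (auto simp: toppled_def F_def)
    \<comment> \<open>Neighbours outside \<open>W\<close> return nothing, and 0 is at most
      \<open>M - 1\<close> because \<open>M \<ge> 1\<close>.\<close>
    moreover have "(M - 1) * (int (card ?S) - int (deg adj x)) \<le> 0"
      using M1 calculation(2) by (intro mult_nonneg_nonpos) auto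
    ultimately have "int (\<zeta> x) + int (deg adj x) \<le> int (\<eta> x) + int (nbr_deg F x)"
      by (simp add: algebra_simps)
    then show ?thesis by linarith
  qed
qed

text \<open>Otherwise the vertex of the maximal set that can burn in \<zeta> would have height at
  least its degree in \<eta>, against stability.\<close>

lemma toppled_allowed_nonpos:
  assumes "\<eta> \<in> A" "\<zeta> \<in> A" "toppled \<eta> n \<zeta>" "x \<in> W"
  shows "n x \<le> 0"
proof (rule ccontr)
  assume "\<not> n x \<le> 0"
  then have "\<exists>x\<in>W. n x \<ge> 1" using assms(4) by force
  then obtain F where F: "F \<subseteq> W" "F \<noteq> {}" "\<And>x. x \<in> F \<Longrightarrow> \<zeta> x + deg adj x \<le> \<eta> x + nbr_deg F x"
    using toppled_maximum[OF assms(3)] by blast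
  have "no_forbidden W E \<zeta>" using assms(2) by (simp add: A_iff)
  then obtain y where y: "y \<in> F" "nbr_deg F y \<le> \<zeta> y" using F(1,2) by (rule no_forbidden_nbr)
  have "\<eta> y < deg adj y" using assms(1) y F(1) by (auto simp: A_iff stable_configs_def stable_def)
  then show False using F(3)[OF y(1)] y(2) by linarith
qed

text \<open>The sign bound applies to \<open>n\<close> and to \<open>- n\<close>, so each class of
  configurations modulo topplings contains at most one allowed one.\<close>

lemma toppled_allowed_unique:
  assumes "\<eta> \<in> A" "\<zeta> \<in> A" "toppled \<eta> n \<zeta>"
  shows "\<eta> = \<zeta>"
proof
  fix x
  have n0: "n y = 0" if "y \<in> W" for y
    using toppled_allowed_nonpos[OF assms that]
      toppled_allowed_nonpos[OF assms(2,1) toppled_uminus[OF assms(3)] that] by simp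
  show "\<eta> x = \<zeta> x"
  proof (cases "x \<in> W")
    case True
    then show ?thesis using assms(3) n0 by (simp add: toppled_def)
  next
    case False
    then show ?thesis using assms(1,2) by (simp add: A_iff stable_configs_def)
  qed
qed

lemma topple_step_toppled:
  assumes "topple_step adj W \<eta> \<zeta>"
  shows "\<exists>x\<in>W. toppled \<eta> (\<lambda>y. if y = x then 1 else 0) \<zeta>"
proof -
  obtain x where x: "x \<in> W" "deg adj x \<le> \<eta> x"
    and \<zeta>: "\<zeta> = (\<lambda>y. if y = x then \<eta> y - deg adj x else if y \<in> W \<and> adj x y then \<eta> y + 1 else \<eta> y)"
    using assms unfolding topple_step_def by blast
  have "(\<Sum>y\<in>{y \<in> W. adj z y}. if y = x then 1 else 0 :: int) = (if adj x z then 1 else 0)" for z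
    using x finW adj_sym by (simp add: sum.delta)
  then show ?thesis
    using x adj_irrefl by (intro bexI[of _ x]) (auto simp: toppled_def \<zeta>)
qed

lemma topple_steps_toppled:
  assumes "(topple_step adj W)\<^sup>+\<^sup>+ \<eta> \<zeta>"
  shows "\<exists>n. (\<forall>x. n x \<ge> 0) \<and> (\<exists>x\<in>W. n x \<ge> 1) \<and> toppled \<eta> n \<zeta>"
  using assms
proof (induction rule: tranclp_induct)
  case (base \<zeta>)
  then obtain x where "x \<in> W" "toppled \<eta> (\<lambda>y. if y = x then 1 else 0) \<zeta>"
    using topple_step_toppled by blast
  then show ?case by (intro exI[of _ "\<lambda>y. if y = x then 1 else 0"]) auto
next
  case (step \<zeta> \<xi>)
  then obtain n where n: "\<forall>x. n x \<ge> 0" "\<exists>x\<in>W. n x \<ge> 1" "toppled \<eta> n \<zeta>" by blast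
  obtain x where "x \<in> W" "toppled \<zeta> (\<lambda>y. if y = x then 1 else 0) \<xi>"
    using step.hyps topple_step_toppled by blast
  then have "toppled \<eta> (\<lambda>y. n y + (if y = x then 1 else 0)) \<xi>"
    using toppled_add n by blast
  then show ?case using n by (intro exI[of _ "\<lambda>y. n y + (if y = x then 1 else 0)"]) force
qed

lemma topple_steps_toppled':
  assumes "(topple_step adj W)\<^sup>*\<^sup>* \<eta> \<zeta>"
  shows "\<exists>n. toppled \<eta> n \<zeta>"
proof (cases "\<eta> = \<zeta>")
  case True
  then show ?thesis by (intro exI[of _ "\<lambda>_. 0"]) (simp add: toppled_def)
next
  case False
  then show ?thesis using assms topple_steps_toppled by (metis rtranclpD)
qed

text \<open>Returning to the start loses no grains, so by the maximum principle the maximal set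
  would contain all neighbours of its vertices; but a finite set leaks.\<close>

lemma topple_acyclic: "\<not> (topple_step adj W)\<^sup>+\<^sup>+ \<eta> \<eta>"
proof
  assume "(topple_step adj W)\<^sup>+\<^sup>+ \<eta> \<eta>"
  then obtain n where n: "\<exists>x\<in>W. n x \<ge> 1" "toppled \<eta> n \<eta>" using topple_steps_toppled by blast
  obtain F where F: "F \<subseteq> W" "F \<noteq> {}" "\<And>x. x \<in> F \<Longrightarrow> \<eta> x + deg adj x \<le> \<eta> x + nbr_deg F x"
    using toppled_maximum[OF n(2,1)] by blast
  have "y \<in> F" if "x \<in> F" "adj x y" for x y
    using F(3)[OF that(1)] nbr_deg_le[of F x] that(2) by (intro nbr_deg_eq_deg[of F x]) auto
  then show False using exists_exit[of F] F(1,2) finW WV finite_subset by blast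
qed

lemma topple_step_sum_le:
  assumes "topple_step adj W \<eta> \<zeta>"
  shows "(\<Sum>x\<in>W. \<zeta> x) \<le> (\<Sum>x\<in>W. \<eta> x)"
proof -
  obtain x where x: "x \<in> W" "deg adj x \<le> \<eta> x"
    and \<zeta>: "\<zeta> = (\<lambda>y. if y = x then \<eta> y - deg adj x else if y \<in> W \<and> adj x y then \<eta> y + 1 else \<eta> y)"
    using assms unfolding topple_step_def by blast
  have "(\<Sum>y\<in>W - {x}. \<zeta> y) = (\<Sum>y\<in>W - {x}. \<eta> y + (if adj x y then 1 else 0))"
    by (rule sum.cong) (auto simp: \<zeta>)
  also have "\<dots> = (\<Sum>y\<in>W - {x}. \<eta> y) + nbr_deg (W - {x}) x"
    using finW by (simp add: sum.distrib nbr_deg_def sum.If_cases Int_def conj_commute)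
  also have "\<dots> \<le> (\<Sum>y\<in>W - {x}. \<eta> y) + deg adj x" using nbr_deg_le by simp
  finally show ?thesis using x finW by (simp add: sum.remove[of W x] \<zeta>)
qed

lemma topple_outside:
  "(topple_step adj W)\<^sup>*\<^sup>* \<eta> \<zeta> \<Longrightarrow> y \<notin> W \<Longrightarrow> \<zeta> y = \<eta> y"
  by (induction rule: rtranclp_induct) (auto simp: topple_step_def)

text \<open>Topplings never increase the number of grains, so only finitely many configurations are
  reachable; without cycles among them one has no successor, and it is stable.\<close>

lemma stabilization_exists:
  assumes "\<And>y. y \<notin> W \<Longrightarrow> \<eta> y = 0"
  shows "\<exists>\<zeta>. (topple_step adj W)\<^sup>*\<^sup>* \<eta> \<zeta> \<and> stable adj W \<zeta>"
proof -
  let ?X = "{\<zeta>. (topple_step adj W)\<^sup>*\<^sup>* \<eta> \<zeta>}"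
  let ?r = "{(\<xi>, \<zeta>). \<xi> \<in> ?X \<and> \<zeta> \<in> ?X \<and> topple_step adj W \<zeta> \<xi>}"
  have sum_le: "(\<Sum>x\<in>W. \<zeta> x) \<le> (\<Sum>x\<in>W. \<eta> x)" if "\<zeta> \<in> ?X" for \<zeta>
    using that[simplified]
    by (induction rule: rtranclp_induct) (use topple_step_sum_le le_trans in blast)+
  have "\<zeta> x \<le> (\<Sum>x\<in>W. \<eta> x)" if "\<zeta> \<in> ?X" "x \<in> W" for \<zeta> x
  proof -
    have "\<zeta> x \<le> (\<Sum>x\<in>W. \<zeta> x)" using that(2) finW by (intro member_le_sum) auto
    also have "\<dots> \<le> (\<Sum>x\<in>W. \<eta> x)" using sum_le[OF that(1)] .
    finally show ?thesis .
  qed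
  moreover have "\<zeta> x = 0" if "\<zeta> \<in> ?X" "x \<notin> W" for \<zeta> x
    using topple_outside[of \<eta> \<zeta> x] that assms by simp
  ultimately have "?X \<subseteq> {\<zeta>. \<forall>x. (x \<in> W \<longrightarrow> \<zeta> x \<in> {..\<Sum>x\<in>W. \<eta> x}) \<and> (x \<notin> W \<longrightarrow> \<zeta> x = 0)}"
    by blast
  then have finX: "finite ?X"
    using finite_set_of_finite_funs[OF finW, of "{..\<Sum>x\<in>W. \<eta> x}" 0] finite_subset by blast
  have "finite ?r" by (rule finite_subset[of _ "?X \<times> ?X"]) (use finX in auto)
  moreover have "acyclic ?r"
  proof (rule acyclicI, intro allI notI)
    fix \<zeta> assume "(\<zeta>, \<zeta>) \<in> ?r\<^sup>+"
    moreover have "(topple_step adj W)\<^sup>+\<^sup>+ b a" if "(a, b) \<in> ?r\<^sup>+" for a b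
      using that by (induction rule: trancl_induct) (auto intro: tranclp_into_tranclp2 tranclp.intros)
    ultimately show False using topple_acyclic by blast
  qed
  ultimately have "wf ?r" by (rule finite_acyclic_wf)
  moreover have "\<eta> \<in> ?X" by simp
  ultimately obtain \<zeta> where \<zeta>: "\<zeta> \<in> ?X" "\<And>\<xi>. (\<xi>, \<zeta>) \<in> ?r \<Longrightarrow> \<xi> \<notin> ?X"
    unfolding wf_eq_minimal by blast
  have "\<not> topple_step adj W \<zeta> \<xi>" for \<xi>
  proof
    assume "topple_step adj W \<zeta> \<xi>"
    moreover from this have "\<xi> \<in> ?X" using \<zeta>(1) by (auto intro: rtranclp.rtrancl_into_rtrancl)
    ultimately show False using \<zeta> by blast
  qed
  then have "stable adj W \<zeta>" by (fastforce simp: topple_step_def stable_def)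
  then show ?thesis using \<zeta>(1) by blast
qed

text \<open>Take the burning vertex of \<open>F - {x}\<close>, where \<open>x\<close> topples:
  putting \<open>x\<close> back raises its inner degree by at most one, and only if it is adjacent
  to \<open>x\<close> and so has received a grain.\<close>

lemma no_forbidden_topple:
  assumes "topple_step adj W \<eta> \<zeta>" "no_forbidden W E \<eta>"
  shows "no_forbidden W E \<zeta>"
proof (rule no_forbidden_nbrI)
  fix F assume F: "F \<subseteq> W" "F \<noteq> {}"
  obtain x where x: "x \<in> W"
    and \<zeta>: "\<zeta> = (\<lambda>y. if y = x then \<eta> y - deg adj x else if y \<in> W \<and> adj x y then \<eta> y + 1 else \<eta> y)"
    using assms unfolding topple_step_def by blast
  show "\<exists>y\<in>F. nbr_deg F y \<le> \<zeta> y"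
  proof (cases "F = {x}")
    case True
    then have "{y \<in> F. adj x y} = {}" using adj_irrefl by auto
    then have "nbr_deg F x = 0" unfolding nbr_deg_def by (simp only: card.empty)
    then show ?thesis using True by (intro bexI[of _ x]) simp_all
  next
    case False
    then have "F - {x} \<subseteq> W" "F - {x} \<noteq> {}" using F by auto
    with assms(2) obtain y where y: "y \<in> F - {x}" "nbr_deg (F - {x}) y \<le> \<eta> y"
      by (rule no_forbidden_nbr)
    have "{z \<in> F. adj y z} \<subseteq> {z \<in> F - {x}. adj y z} \<union> (if adj x y then {x} else {})"
      using adj_sym by auto
    then have "card {z \<in> F. adj y z} \<le> card ({z \<in> F - {x}. adj y z} \<union> (if adj x y then {x} else {}))"
      by (rule card_mono[rotated]) auto
    also have "\<dots> \<le> nbr_deg (F - {x}) y + card (if adj x y then {x} else {})"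
      unfolding nbr_deg_def by (rule card_Un_le)
    finally have "nbr_deg F y \<le> nbr_deg (F - {x}) y + (if adj x y then 1 else 0)"
      by (simp add: nbr_deg_def split: if_splits)
    then show ?thesis using y F by (intro bexI[of _ y]) (auto simp: \<zeta> split: if_splits)
  qed
qed

lemma no_forbidden_mono:
  assumes "no_forbidden W E \<eta>" "\<And>x. x \<in> W \<Longrightarrow> \<eta> x \<le> \<zeta> x"
  shows "no_forbidden W E \<zeta>"
proof (rule no_forbidden_nbrI)
  fix F assume F: "F \<subseteq> W" "F \<noteq> {}"
  obtain y where "y \<in> F" "nbr_deg F y \<le> \<eta> y" using assms(1) F by (rule no_forbidden_nbr)
  then show "\<exists>y\<in>F. nbr_deg F y \<le> \<zeta> y" using assms(2)[of y] F by force
qed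

lemma add_stabilize_allowed:
  assumes "\<eta> \<in> A" "x \<in> W" "(topple_step adj W)\<^sup>*\<^sup>* (\<eta>(x := \<eta> x + 1)) \<zeta>" "stable adj W \<zeta>"
  shows "\<zeta> \<in> A"
proof -
  have "no_forbidden W E \<eta>" using assms by (simp add: A_iff)
  then have "no_forbidden W E (\<eta>(x := \<eta> x + 1))" by (rule no_forbidden_mono) auto
  then have "no_forbidden W E \<zeta>"
    using assms(3)[THEN rtranclp_induct, of "no_forbidden W E"] no_forbidden_topple by blast
  moreover have "\<zeta> y = 0" if "y \<notin> W" for y
    using topple_outside[OF assms(3) that] assms(1,2) that by (auto simp: A_iff stable_configs_def)
  ultimately show ?thesis using assms(4) by (simp add: A_iff stable_configs_def)
qed

text \<open>"Add a particle at x and stabilize" is a total relation on the finite set A, and by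
uniqueness in each toppling class no element of A has two predecessors.  Hence the relation is the
graph of a permutation, and the abelian property is not needed.\<close>

lemma sandpile_step_reversible:
  assumes "\<eta> \<in> A" and step: "sandpile_step adj W \<eta> \<zeta>"
  shows "\<zeta> \<in> A \<and> (sandpile_step adj W)\<^sup>*\<^sup>* \<zeta> \<eta>"
proof -
  obtain x where x: "x \<in> W" "(topple_step adj W)\<^sup>*\<^sup>* (\<eta>(x := \<eta> x + 1)) \<zeta>" "stable adj W \<zeta>"
    using step by (auto simp: sandpile_step_def)
  have \<zeta>A: "\<zeta> \<in> A" using assms(1) x by (rule add_stabilize_allowed)
  define R where "R a b \<longleftrightarrow> (topple_step adj W)\<^sup>*\<^sup>* (a(x := a x + 1)) b \<and> stable adj W b" for a b
  have total: "\<exists>b. R a b" if "a \<in> A" for a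
    unfolding R_def by (rule stabilization_exists) (use that x in \<open>auto simp: A_iff stable_configs_def\<close>)
  have closed: "b \<in> A" if "a \<in> A" "R a b" for a b
    using add_stabilize_allowed[OF that(1) x(1)] that(2) by (simp add: R_def)
  \<comment> \<open>Undoing the topplings and the added grain relates \<open>a\<close> and
    \<open>a'\<close> by a toppling vector, possibly with negative entries.\<close>
  have coinj: "a = a'" if a: "a \<in> A" "a' \<in> A" "R a b" "R a' b" for a a' b
  proof -
    obtain n m where "toppled (a(x := a x + 1)) n b" "toppled (a'(x := a' x + 1)) m b"
      using topple_steps_toppled' a unfolding R_def by blast
    then have "toppled (a(x := a x + 1)) (\<lambda>y. n y + - m y) (a'(x := a' x + 1))"
      using toppled_add toppled_uminus by blast
    then have "toppled a (\<lambda>y. n y + - m y) a'"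
      unfolding toppled_def by (intro ballI) (drule bspec, assumption, simp split: if_splits)
    then show ?thesis using toppled_allowed_unique a by blast
  qed
  define f where "f a = (SOME b. R a b)" for a
  have Rf: "R a (f a)" if "a \<in> A" for a unfolding f_def using total[OF that] by (rule someI_ex)
  have inj: "inj_on f A" using coinj Rf by (metis inj_onI)
  have "f ` A \<subseteq> A" using closed Rf by blast
  then have "f ` A = A" using finite_A inj by (simp add: endo_inj_surj)
  then obtain a where a: "a \<in> A" "\<zeta> = f a" using \<zeta>A by blast
  \<comment> \<open>The given \<zeta> is not yet known to be the chosen value
    \<open>f \<eta>\<close>. Surjectivity makes it some \<open>f a\<close>, and the absence of two
    predecessors identifies \<open>a\<close> with \<eta>.\<close>
  then have "a = \<eta>" using coinj[of a \<eta> \<zeta>] Rf[of a] assms(1) x by (auto simp: R_def)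
  then have \<zeta>: "\<zeta> = f \<eta>" using a by simp
  have f_step: "sandpile_step adj W a (f a)" if "a \<in> A" for a
    using that Rf[OF that] x(1) by (auto simp: sandpile_step_def R_def A_iff)
  define Orb where "Orb = {b \<in> A. (sandpile_step adj W)\<^sup>*\<^sup>* \<zeta> b}"
  \<comment> \<open>If \<eta> were missing, \<open>f\<close> would map
    \<open>insert \<eta> Orb\<close> injectively into the smaller finite set
    \<open>Orb\<close>.\<close>
  have "\<eta> \<in> Orb"
  proof (rule ccontr)
    assume "\<eta> \<notin> Orb"
    have fin: "finite Orb" using finite_A by (simp add: Orb_def)
    have "f b \<in> Orb" if "b \<in> insert \<eta> Orb" for b
    proof (cases "b = \<eta>")
      case True
      then show ?thesis using \<zeta> \<zeta>A by (simp add: Orb_def)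
    next
      case False
      then have "b \<in> A" "(sandpile_step adj W)\<^sup>*\<^sup>* \<zeta> b" using that by (auto simp: Orb_def)
      then show ?thesis
        using f_step[of b] \<open>f ` A \<subseteq> A\<close> by (auto simp: Orb_def intro: rtranclp.rtrancl_into_rtrancl)
    qed
    then have "f ` insert \<eta> Orb \<subseteq> Orb" by blast
    moreover have "inj_on f (insert \<eta> Orb)"
      using inj by (rule inj_on_subset) (use assms(1) in \<open>auto simp: Orb_def\<close>)
    ultimately have "card (insert \<eta> Orb) \<le> card Orb" using fin by (intro card_inj_on_le)
    then show False using \<open>\<eta> \<notin> Orb\<close> fin by simp
  qed
  then show ?thesis using \<zeta>A by (simp add: Orb_def)
qed

definition max_config :: "'a \<Rightarrow> nat" where
  "max_config x = (if x \<in> W then deg adj x - 1 else 0)"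

lemma max_config_allowed: "max_config \<in> A"
proof -
  have "no_forbidden W E max_config"
  proof (rule no_forbidden_nbrI)
    fix F assume F: "F \<subseteq> W" "F \<noteq> {}"
    then obtain x y where x: "x \<in> F" "adj x y" "y \<notin> F"
      using exists_exit[of F] finW WV finite_subset by blast
    then have "nbr_deg F x \<noteq> deg adj x" using nbr_deg_eq_deg by blast
    then have "nbr_deg F x \<le> max_config x"
      using nbr_deg_le[of F x] x(1) F(1) by (auto simp: max_config_def)
    then show "\<exists>x\<in>F. nbr_deg F x \<le> max_config x" using x(1) by blast
  qed
  moreover have "max_config x < deg adj x" if "x \<in> W" for x
    using deg_pos[of x] that WV by (auto simp: max_config_def)
  ultimately show ?thesis
    by (simp add: A_iff stable_configs_def stable_def) (simp add: max_config_def)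
qed

text \<open>Grains are added one at a time where the height is below its maximum, so nothing
  topples.\<close>

lemma reaches_max_config:
  assumes "\<eta> \<in> stable_configs adj W"
  shows "(sandpile_step adj W)\<^sup>*\<^sup>* \<eta> max_config"
  using assms
proof (induction "\<Sum>x\<in>W. max_config x - \<eta> x" arbitrary: \<eta> rule: less_induct)
  case less
  have le: "\<eta> x \<le> max_config x" for x
    using less.prems by (cases "x \<in> W") (auto simp: max_config_def stable_configs_def stable_def)
  show ?case
  proof (cases "\<eta> = max_config")
    case False
    then obtain x where "\<eta> x \<noteq> max_config x" by auto
    then have x: "\<eta> x < max_config x" "x \<in> W"
      using le[of x] less.prems by (auto simp: max_config_def stable_configs_def split: if_splits)
    let ?\<zeta> = "\<eta>(x := \<eta> x + 1)"
    have \<zeta>: "?\<zeta> \<in> stable_configs adj W"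
      using less.prems x by (auto simp: stable_configs_def stable_def max_config_def)
    then have "sandpile_step adj W \<eta> ?\<zeta>"
      using less.prems x by (auto simp: sandpile_step_def stable_configs_def)
    moreover have "(\<Sum>x\<in>W. max_config x - ?\<zeta> x) < (\<Sum>x\<in>W. max_config x - \<eta> x)"
      using x finW by (intro sum_strict_mono_ex1) (auto intro!: bexI[of _ x])
    ultimately show ?thesis using less.hyps[OF _ \<zeta>] by (meson converse_rtranclp_into_rtranclp)
  qed simp
qed

text \<open>A recurrent configuration reaches \<open>max_config\<close> and hence is reached back
  from it, and steps never leave \<open>A\<close>. Conversely, every step from \<open>A\<close> can
  be undone by further steps.\<close>

theorem recurrent_iff_allowed: "recurrent adj W \<eta> \<longleftrightarrow> \<eta> \<in> A"
proof
  have reach: "\<zeta> \<in> A \<and> (sandpile_step adj W)\<^sup>*\<^sup>* \<zeta> \<eta>"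
    if "\<eta> \<in> A" "(sandpile_step adj W)\<^sup>*\<^sup>* \<eta> \<zeta>" for \<eta> \<zeta>
    using that(2)
  proof (induction rule: rtranclp_induct)
    case (step \<zeta> \<xi>)
    then show ?case using sandpile_step_reversible[of \<zeta> \<xi>] by (auto intro: rtranclp_trans)
  qed (use that in simp)
  {
    assume r: "recurrent adj W \<eta>"
    then have "(sandpile_step adj W)\<^sup>*\<^sup>* max_config \<eta>"
      using reaches_max_config by (auto simp: recurrent_def)
    then show "\<eta> \<in> A" using reach[OF max_config_allowed] by blast
  next
    assume \<eta>: "\<eta> \<in> A"
    then show "recurrent adj W \<eta>" using reach[OF \<eta>] by (auto simp: recurrent_def A_iff)
  }
qed

end

section \<open>Finite exit sets in one-ended trees\<close>

text \<open>\<open>S\<close> collects the vertices already visited. Each reachable point other than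
  \<open>x\<close> is reached after a last departure from \<open>x\<close>, so one of the finitely
  many next vertices still reaches infinitely many points while avoiding \<open>x\<close>.\<close>

lemma koenig_step:
  assumes "infinite {z. (\<lambda>a b. R a b \<and> a \<notin> S \<and> b \<notin> S)\<^sup>*\<^sup>* x z}" "finite {y. R x y}"
  shows "\<exists>y. R x y \<and> y \<notin> insert x S \<and>
    infinite {z. (\<lambda>a b. R a b \<and> a \<notin> insert x S \<and> b \<notin> insert x S)\<^sup>*\<^sup>* y z}"
proof (rule ccontr)
  assume none: "\<not> ?thesis"
  let ?N = "{y. R x y \<and> y \<notin> insert x S}"
  let ?reach = "\<lambda>y. {z. (\<lambda>a b. R a b \<and> a \<notin> insert x S \<and> b \<notin> insert x S)\<^sup>*\<^sup>* y z}"
  have "z \<in> insert x (\<Union>y\<in>?N. ?reach y)"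
    if z: "(\<lambda>a b. R a b \<and> a \<notin> S \<and> b \<notin> S)\<^sup>*\<^sup>* x z" for z
  proof (cases "x = z")
    case False
    obtain y where y: "R x y \<and> x \<notin> S \<and> y \<notin> S"
      and yz: "(\<lambda>a b. (R a b \<and> a \<notin> S \<and> b \<notin> S) \<and> a \<noteq> x \<and> b \<noteq> x)\<^sup>*\<^sup>* y z"
      using rtranclp_last_visit[OF z False] by blast
    have "y \<noteq> x" using yz False by (auto elim: converse_rtranclpE)
    moreover have "z \<in> ?reach y" using yz by (simp add: conj_ac)
    ultimately show ?thesis using y by blast
  qed simp
  then have "{z. (\<lambda>a b. R a b \<and> a \<notin> S \<and> b \<notin> S)\<^sup>*\<^sup>* x z} \<subseteq> insert x (\<Union>y\<in>?N. ?reach y)"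
    by blast
  moreover have "finite (insert x (\<Union>y\<in>?N. ?reach y))"
  proof -
    have "finite ?N" by (rule finite_subset[OF _ assms(2)]) auto
    then show ?thesis using none by blast
  qed
  ultimately show False using assms(1) finite_subset by blast
qed

lemma koenig:
  assumes "infinite {z. R\<^sup>*\<^sup>* x z}" "\<And>x. finite {y. R x y}"
  shows "\<exists>p. inj p \<and> p 0 = x \<and> (\<forall>i::nat. R (p i) (p (Suc i)))"
proof -
  define reach where "reach S x = {z. (\<lambda>a b. R a b \<and> a \<notin> S \<and> b \<notin> S)\<^sup>*\<^sup>* x z}" for S x
  \<comment> \<open>The state is the current vertex with the set of earlier ones; remembering that
    set makes the resulting path self-avoiding.\<close>
  let ?P = "\<lambda>n s. (n = 0 \<longrightarrow> s = (x, {})) \<and> fst s \<notin> snd s \<and> infinite (reach (snd s) (fst s))"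
  let ?Q = "\<lambda>n s t. R (fst s) (fst t) \<and> snd t = insert (fst s) (snd s)"
  obtain f where f: "\<And>n::nat. ?P n (f n)" "\<And>n. ?Q n (f n) (f (Suc n))"
  proof (rule dependent_nat_choice[of ?P ?Q, THEN exE])
    show "\<exists>s. ?P 0 s" using assms(1) by (intro exI[of _ "(x, {})"]) (simp add: reach_def)
    show "\<exists>t. ?P (Suc n) t \<and> ?Q n s t" if s: "?P n s" for s n
    proof -
      obtain y where "R (fst s) y" "y \<notin> insert (fst s) (snd s)"
        "infinite (reach (insert (fst s) (snd s)) y)"
        using koenig_step[of R "snd s" "fst s"] s assms(2) unfolding reach_def by blast
      then show ?thesis by (intro exI[of _ "(y, insert (fst s) (snd s))"]) simp
    qed
  qed blast
  have visited: "fst (f i) \<in> snd (f (Suc (i + k)))" for i k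
    by (induction k) (use f(2) in auto)
  have "fst (f i) \<noteq> fst (f j)" if "i < j" for i j
    using visited[of i "j - i - 1"] f(1)[of j] that by auto
  then have "inj (\<lambda>i. fst (f i))" by (metis injI linorder_neqE_nat)
  then show ?thesis using f by (intro exI[of _ "\<lambda>i. fst (f i)"]) auto
qed

context sandpile_graph
begin

text \<open>The complement of D is the unique infinite component of F with K deleted.\<close>

lemma finite_exit_set:
  assumes F: "F \<subseteq> edges adj" and tree: "single_tree V F" and ends: "one_ended F"
    and K: "finite K" "K \<subseteq> V"
  shows "\<exists>D. finite D \<and> K \<subseteq> D \<and> D \<subseteq> V \<and>
    F \<inter> touching (edges adj) D \<in> wired_trees D (exit_edges (edges adj) K D)"
proof (cases "K = {}")
  case True
  have "F \<inter> touching (edges adj) {} \<in> wired_trees {} (exit_edges (edges adj) K {})"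
    by (simp add: touching_def wired_trees_def wired_connected_def wired_acyclic_def)
  then show ?thesis using True by blast
next
  case False
  then obtain k where k: "k \<in> K" by auto
  have F_adj: "adj x y" if "{x, y} \<in> F" for x y
  proof -
    have "{x, y} \<in> edges adj" using that F by (rule rev_subsetD)
    then obtain a b where "{x, y} = {a, b}" "adj a b" unfolding edges_def by blast
    then have "adj a b" "x = a \<and> y = b \<or> x = b \<and> y = a" by (auto simp: doubleton_eq_iff)
    then show ?thesis using adj_sym by blast
  qed
  have F_V: "x \<in> V \<and> y \<in> V \<and> x \<noteq> y" if "{x, y} \<in> F" for x y
    using F_adj[OF that] adj_V adj_irrefl by blast
  define R where "R a b \<longleftrightarrow> {a, b} \<in> F \<and> a \<notin> K \<and> b \<notin> K" for a b
  have R_sym: "R\<^sup>*\<^sup>* b a" if "R\<^sup>*\<^sup>* a b" for a b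
  proof -
    have "symp R" by (auto simp: symp_def R_def insert_commute)
    then show ?thesis using that by (meson symp_rtranclp sympD)
  qed
  have conn_F: "forest_conn F x y" if "x \<in> V" "y \<in> V" for x y
    using tree that by (simp add: single_tree_def)
  have fin_R: "finite {y. R x y}" for x
    by (rule finite_subset[OF _ finite_nbrs[of x]]) (auto simp: R_def F_adj)
  \<comment> \<open>By Koenig's lemma two infinite components each contain a ray; one-endedness
    makes the rays meet, so the components coincide.\<close>
  have one_infinite: "R\<^sup>*\<^sup>* x y" if x: "infinite {z. R\<^sup>*\<^sup>* x z}" and y: "infinite {z. R\<^sup>*\<^sup>* y z}" for x y
  proof -
    have ray: "\<exists>p. inf_sa_path F p \<and> (\<forall>i. R\<^sup>*\<^sup>* x (p i))" if inf: "infinite {z. R\<^sup>*\<^sup>* x z}" for x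
    proof -
      obtain p where p: "inj p" "p 0 = x" "\<And>i::nat. R (p i) (p (Suc i))"
        using koenig[OF inf fin_R] by blast
      have "R\<^sup>*\<^sup>* x (p i)" for i
        by (induction i) (use p in \<open>auto intro: rtranclp.rtrancl_into_rtrancl\<close>)
      then show ?thesis using p by (auto simp: inf_sa_path_def R_def)
    qed
    obtain p q where p: "inf_sa_path F p" "\<And>i. R\<^sup>*\<^sup>* x (p i)" and q: "inf_sa_path F q" "\<And>i. R\<^sup>*\<^sup>* y (q i)"
      using ray[OF x] ray[OF y] by blast
    have "infinite (range p \<inter> range q)" using ends p(1) q(1) by (auto simp: one_ended_def)
    then have "range p \<inter> range q \<noteq> {}" by auto
    then obtain i j where "p i = q j" by blast
    then show ?thesis using p(2)[of i] R_sym[OF q(2)[of j]] by simp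
  qed
  \<comment> \<open>Each vertex outside \<open>K\<close> is joined, avoiding \<open>K\<close>, to
    the vertex just before the first hit of \<open>K\<close> on a path to \<open>K\<close>, and that
    vertex lies in \<open>N\<close>. Hence the finite set \<open>N\<close> meets all
    components.\<close>
  define N where "N = {y. (\<exists>k\<in>K. adj k y) \<and> y \<notin> K}"
  have finN: "finite N"
    by (rule finite_subset[of _ "\<Union>k\<in>K. {y. adj k y}"]) (use K in \<open>auto simp: N_def\<close>)
  have first_hit: "w \<notin> K \<and> R\<^sup>*\<^sup>* v w \<or> (\<exists>y\<in>N. R\<^sup>*\<^sup>* v y)" if "forest_conn F v w" "v \<notin> K" for v w
    using that(1) unfolding forest_conn_def
  proof (induction rule: rtranclp_induct)
    case (step w w')
    show ?case
    proof (cases "\<exists>y\<in>N. R\<^sup>*\<^sup>* v y")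
      case no: False
      then have w: "w \<notin> K" "R\<^sup>*\<^sup>* v w" using step.IH by auto
      show ?thesis
      proof (cases "w' \<in> K")
        case True
        moreover have "adj w' w" using step.hyps F_adj[of w w'] adj_sym by blast
        ultimately have "w \<in> N" using w unfolding N_def by blast
        then show ?thesis using w by blast
      next
        case False
        then have "R w w'" using step.hyps w by (auto simp: R_def)
        then show ?thesis using w False by (auto intro: rtranclp.rtrancl_into_rtrancl)
      qed
    qed simp
  qed (use that in simp)
  have hit: "\<exists>y\<in>N. R\<^sup>*\<^sup>* y v" if "v \<in> V" "v \<notin> K" for v
    using first_hit[OF conn_F[OF that(1), of k] that(2)] k K(2) R_sym by blast
  have "\<exists>y\<in>N. infinite {z. R\<^sup>*\<^sup>* y z}"
  proof (rule ccontr)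
    assume "\<not> ?thesis"
    then have "finite (K \<union> (\<Union>y\<in>N. {z. R\<^sup>*\<^sup>* y z}))" using finN K by blast
    moreover have "V \<subseteq> K \<union> (\<Union>y\<in>N. {z. R\<^sup>*\<^sup>* y z})" using hit by blast
    ultimately show False using inf finite_subset by blast
  qed
  then obtain y0 where y0: "y0 \<in> N" "infinite {z. R\<^sup>*\<^sup>* y0 z}" by blast
  \<comment> \<open>Finitely many components covering an infinite set include an infinite one,
    \<open>Z\<close>; all others are finite and go into \<open>D\<close> together with
    \<open>K\<close>.\<close>
  define Z where "Z = {z. R\<^sup>*\<^sup>* y0 z}"
  define D where "D = V - Z"
  have y0Z: "y0 \<in> Z" by (simp add: Z_def)
  have ZKV: "z \<notin> K \<and> z \<in> V" if "z \<in> Z" for z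
    using that[unfolded Z_def, simplified]
    by (induction rule: rtranclp_induct) (use y0 adj_V in \<open>auto simp: N_def R_def F_V\<close>)
  have Z_step: "b \<in> Z" if "a \<in> Z" "R a b" for a b
    using that by (auto simp: Z_def intro: rtranclp.rtrancl_into_rtrancl)
  have "finite D"
  proof (rule finite_subset)
    show "D \<subseteq> K \<union> (\<Union>y\<in>{y \<in> N. finite {z. R\<^sup>*\<^sup>* y z}}. {z. R\<^sup>*\<^sup>* y z})"
    proof
      fix v assume v: "v \<in> D"
      show "v \<in> K \<union> (\<Union>y\<in>{y \<in> N. finite {z. R\<^sup>*\<^sup>* y z}}. {z. R\<^sup>*\<^sup>* y z})"
      proof (cases "v \<in> K")
        case False
        then obtain y where y: "y \<in> N" "R\<^sup>*\<^sup>* y v" using hit[of v] v by (auto simp: D_def)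
        have "finite {z. R\<^sup>*\<^sup>* y z}"
        proof (rule ccontr)
          assume "infinite {z. R\<^sup>*\<^sup>* y z}"
          then have "R\<^sup>*\<^sup>* y0 v" using one_infinite[OF y0(2)] y(2) by (blast intro: rtranclp_trans)
          then show False using v by (simp add: D_def Z_def)
        qed
        then show ?thesis using y by blast
      qed simp
    qed
    show "finite (K \<union> (\<Union>y\<in>{y \<in> N. finite {z. R\<^sup>*\<^sup>* y z}}. {z. R\<^sup>*\<^sup>* y z}))"
      using K finN by auto
  qed
  moreover have "K \<subseteq> D" using K ZKV by (auto simp: D_def)
  moreover have "D \<subseteq> V" by (auto simp: D_def)
  moreover have "F \<inter> touching (edges adj) D \<in> wired_trees D (exit_edges (edges adj) K D)"
  proof -
    let ?T = "F \<inter> touching (edges adj) D"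
    have T_iff: "{a, b} \<in> ?T" if "{a, b} \<in> F" "a \<in> D" for a b
      using that F by (auto simp: touching_def)
    have "e \<in> exit_edges (edges adj) K D" if e: "e \<in> ?T" for e
    proof -
      have eE: "e \<in> edges adj" "e \<inter> D \<noteq> {}" "e \<in> F" using e by (auto simp: touching_def)
      then obtain a b where ab: "e = {a, b}" "a \<in> D" by (auto simp: edges_def)
      have "b \<in> D" if "e \<inter> K = {}"
      proof (rule ccontr)
        assume "b \<notin> D"
        then have "b \<in> Z" using F_V[of a b] eE ab by (auto simp: D_def)
        moreover have "R b a" using that eE ab by (auto simp: R_def insert_commute)
        ultimately show False using Z_step ab by (auto simp: D_def)
      qed
      then show ?thesis using eE ab by (auto simp: exit_edges_def)
    qed
    moreover have "wired_connected D ?T"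
      unfolding wired_connected_def
    proof
      fix x assume x: "x \<in> D"
      have "w \<in> D \<and> wconn D ?T x w \<or> (\<exists>s. s \<notin> D \<and> wconn D ?T x s)" if "forest_conn F x w" for w
        using that unfolding forest_conn_def
      proof (induction rule: rtranclp_induct)
        case (step w w')
        show ?case
        proof (cases "\<exists>s. s \<notin> D \<and> wconn D ?T x s")
          case False
          then have "w \<in> D" "wconn D ?T x w" using step.IH by auto
          moreover from this have "wconn D ?T w w'" using step.hyps by (intro wconn_edge T_iff) auto
          ultimately have "wconn D ?T x w'" by (blast intro: wconn_trans)
          then show ?thesis by blast
        qed simp
      qed (use x in simp)
      moreover have "forest_conn F x y0" using conn_F x ZKV[OF y0Z] by (simp add: D_def)
      moreover have "y0 \<notin> D" using y0Z by (simp add: D_def)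
      ultimately show "\<exists>s. s \<notin> D \<and> wconn D ?T x s" by blast
    qed
    moreover have "wired_acyclic D ?T"
      unfolding wired_acyclic_def
    proof (intro allI impI notI)
      fix u v assume uv: "{u, v} \<in> ?T" and c: "wconn D (?T - {{u, v}}) u v"
      define F' where "F' = F - {{u, v}}"
      define S where "S = ?T - {{u, v}}"
      have uvD: "u \<in> D \<or> v \<in> D" using uv by (auto simp: touching_def)
      \<comment> \<open>The deleted edge has an end in \<open>D\<close>, so \<open>Z\<close> stays
        connected without it.\<close>
      have within: "forest_conn F' a b" if "a \<in> Z" "R\<^sup>*\<^sup>* a b" for a b
      proof -
        have "b \<in> Z \<and> forest_conn F' a b"
          using that(2) unfolding forest_conn_def
        proof (induction rule: rtranclp_induct)
          case (step b d)
          then have "d \<in> Z" using Z_step by blast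
          moreover have "{b, d} \<in> F' \<and> b \<noteq> d"
            using step.hyps step.IH \<open>d \<in> Z\<close> uvD F_V[of b d]
            by (auto simp: F'_def R_def D_def doubleton_eq_iff)
          ultimately show ?case using step.IH by (auto intro: rtranclp.rtrancl_into_rtrancl)
        qed (use that in simp)
        then show ?thesis by simp
      qed
      have trans: "forest_conn F' a d" if "forest_conn F' a b" "forest_conn F' b d" for a b d
        using that unfolding forest_conn_def by (rule rtranclp_trans)
      \<comment> \<open>Outside \<open>D\<close> lie the vertices of \<open>Z\<close> and the points
        of the type not in \<open>V\<close>. A jump between sink points is imitated by a walk inside
        \<open>Z\<close>; while the original walk is at a point not in \<open>V\<close>, the
        invariant keeps some vertex of \<open>Z\<close> in its place.\<close>
      have main: "(w \<in> V \<longrightarrow> forest_conn F' u w) \<and> (w \<notin> V \<longrightarrow> (\<exists>z\<in>Z. forest_conn F' u z))"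
        if "wconn D S u w" for w
        using that
      proof (induction rule: wconn_induct)
        case (edge y z)
        then have "{y, z} \<in> F'" "{y, z} \<in> F" by (auto simp: S_def F'_def)
        then have "forest_conn F' y z" "y \<in> V" "z \<in> V"
          using F_V[of y z] by (auto simp: forest_conn_def)
        then show ?case using edge.IH trans by blast
      next
        case (outside y z)
        obtain z1 where z1: "z1 \<in> Z" "forest_conn F' u z1"
          using outside by (cases "y \<in> V") (auto simp: D_def)
        show ?case
        proof (cases "z \<in> V")
          case True
          then have "z \<in> Z" using outside by (simp add: D_def)
          then have "R\<^sup>*\<^sup>* z1 z" using z1 R_sym by (auto simp: Z_def intro: rtranclp_trans)
          then show ?thesis using within[OF z1(1)] trans[OF z1(2)] True by blast
        next
          case False
          then show ?thesis using z1 by blast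
        qed
      next
        case refl
        then show ?case using uv F_V[of u v] by (auto simp: forest_conn_def)
      qed
      have "forest_conn (F - {{u, v}}) u v"
        using main[of v] c F_V[of u v] uv by (simp add: S_def F'_def)
      moreover have "{u, v} \<in> F" using uv by simp
      ultimately show False using tree unfolding single_tree_def by blast
    qed
    ultimately show ?thesis by (auto simp: wired_trees_def)
  qed
  ultimately show ?thesis by blast
qed

end

section \<open>Finite-volume comparison of sandpile and tree\<close>

text \<open>Translates between the quotient with its single sink \<open>None\<close> and the picture
  in which all points outside \<open>W\<close> are sink points. The induction covers all
  representatives of a vertex at once, since \<open>None\<close> has many.\<close>

lemma wired_conn_iff_wconn: "wired_conn W T (wq W x) (wq W y) \<longleftrightarrow> wconn W T x y"
proof
  assume "wired_conn W T (wq W x) (wq W y)"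
  then have "\<forall>y. wq W y = v \<longrightarrow> wconn W T x y" if "v = wq W y" for v
    using that unfolding wired_conn_def
  proof (induction "wq W y" arbitrary: v y rule: rtranclp_induct)
    case base
    then show ?case by (auto simp: wq_def intro: wconn_outside split: if_splits)
  next
    case (step u)
    then obtain a b where ab: "{a, b} \<in> T" "wq W a = u" "wq W b = wq W y" by blast
    have "wconn W T x b" using step.hyps(3)[of a] ab by (blast intro: wconn_trans wconn_edge)
    moreover have "wconn W T b y'" if "wq W y' = wq W b" for y'
      using that by (auto simp: wq_def intro: wconn_outside split: if_splits)
    ultimately show ?case using ab step.prems by (metis wconn_trans)
  qed
  then show "wconn W T x y" by blast
next
  assume "wconn W T x y"
  then show "wired_conn W T (wq W x) (wq W y)"
  proof (induction rule: wconn_induct)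
    case (edge y z)
    then show ?case
      by (cases "y = z") (auto simp: wired_conn_def intro: rtranclp.rtrancl_into_rtrancl)
  next
    case (outside y z)
    then show ?case by (simp add: wq_def)
  qed (simp add: wired_conn_def)
qed

context sandpile_graph
begin

definition exit_trees :: "'a set \<Rightarrow> 'a set \<Rightarrow> 'a set set set" where
  "exit_trees K D = wired_trees D (exit_edges (edges adj) K D)"

definition exit_configs :: "'a set \<Rightarrow> 'a set \<Rightarrow> ('a \<Rightarrow> nat) set" where
  "exit_configs K D = allowed_configs D (exit_edges (edges adj) K D)"

text \<open>A condition on the edges at \<open>D\<close> alone. For finite \<open>D\<close> it is a
  local event, so its probability passes to the limit.\<close>

definition exit_event :: "'a set \<Rightarrow> 'a set \<Rightarrow> 'a set set set" where
  "exit_event K D = {T. T \<inter> touching (edges adj) D \<in> exit_trees K D}"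

text \<open>The conditional probability of the heights \<xi> on \<open>K\<close> given the exit set
  \<open>D\<close>, the same in all volumes. Trees may be counted in the denominator because for
  finite \<open>D\<close> they are as many as the configurations; without exit trees the quotient is
  0 by convention.\<close>

definition exit_ratio :: "'a set \<Rightarrow> 'a set \<Rightarrow> ('a \<Rightarrow> nat) \<Rightarrow> real" where
  "exit_ratio K D \<xi> = card {\<zeta> \<in> exit_configs K D. \<forall>x\<in>K. \<zeta> x = \<xi> x} / card (exit_trees K D)"

lemma touching_wired_edges: "D \<subseteq> W \<Longrightarrow> touching (wired_edges adj W) D = touching (edges adj) D"
  by (auto simp: touching_def wired_edges_def)

lemma exit_edges_wired_edges:
  "D \<subseteq> W \<Longrightarrow> exit_edges (wired_edges adj W) K D = exit_edges (edges adj) K D"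
  by (auto simp: exit_edges_def wired_edges_def)

lemma wired_graph_exit: "finite D \<Longrightarrow> wired_graph D (exit_edges (edges adj) K D)"
  using wired_graph_exit_edges[OF wired_graph_wired_edges, of D D K] exit_edges_wired_edges[of D D K]
  by simp

lemma finite_touching: "finite D \<Longrightarrow> finite (touching (edges adj) D)"
  using wired_graph_wired_edges[of D] touching_wired_edges[of D D]
  by (auto simp: wired_graph_def touching_def intro: finite_subset)

lemma card_exit_configs: "finite D \<Longrightarrow> card (exit_configs K D) = card (exit_trees K D)"
  unfolding exit_configs_def exit_trees_def
  by (intro card_allowed_configs_eq_card_wired_trees wired_graph_exit)

lemma finite_exit_trees: "finite D \<Longrightarrow> finite (exit_trees K D)"
  unfolding exit_trees_def by (intro finite_wired_trees wired_graph_exit)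

lemma finite_exit_configs: "finite D \<Longrightarrow> finite (exit_configs K D)"
  unfolding exit_configs_def by (intro finite_allowed_configs wired_graph_exit)

definition cylinders :: "'a set \<Rightarrow> ('a \<Rightarrow> nat) set" where
  "cylinders K = (\<Pi>\<^sub>E x\<in>K. {..<deg adj x})"

lemma finite_cylinders: "finite K \<Longrightarrow> finite (cylinders K)"
  unfolding cylinders_def by (intro finite_PiE) auto

lemma cylinders_eqI:
  "\<xi> \<in> cylinders K \<Longrightarrow> \<xi>' \<in> cylinders K \<Longrightarrow> (\<And>x. x \<in> K \<Longrightarrow> \<xi> x = \<xi>' x) \<Longrightarrow> \<xi> = \<xi>'"
  unfolding cylinders_def by (rule PiE_ext)

lemma exit_configs_less_deg:
  assumes "finite D" "\<zeta> \<in> exit_configs K D" "x \<in> D"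
  shows "\<zeta> x < deg adj x"
proof -
  have "\<zeta> x < edge_deg (exit_edges (edges adj) K D) x"
    using assms by (simp add: exit_configs_def allowed_configs_def)
  also have "\<dots> \<le> edge_deg (wired_edges adj D) x"
    using wired_graph_wired_edges[OF assms(1)] exit_edges_wired_edges[of D D K]
    by (intro edge_deg_mono) (auto simp: wired_graph_def exit_edges_def)
  finally show ?thesis using assms by (simp add: edge_deg_wired_edges)
qed

text \<open>The configurations on \<open>D\<close> are sorted by their heights on \<open>K\<close>;
  equality of the two counts normalises the sum.\<close>

lemma sum_exit_ratio:
  assumes "finite D" "K \<subseteq> D"
  shows "(\<Sum>\<xi>\<in>cylinders K. exit_ratio K D \<xi>) = (if exit_trees K D = {} then 0 else 1)"
proof -
  have finK: "finite K" using assms finite_subset by blast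
  let ?C = "\<lambda>\<xi>. {\<zeta> \<in> exit_configs K D. \<forall>x\<in>K. \<zeta> x = \<xi> x}"
  have "card (\<Union>\<xi>\<in>cylinders K. ?C \<xi>) = (\<Sum>\<xi>\<in>cylinders K. card (?C \<xi>))"
  proof (rule card_UN_disjoint)
    show "\<forall>\<xi>\<in>cylinders K. \<forall>\<xi>'\<in>cylinders K. \<xi> \<noteq> \<xi>' \<longrightarrow> ?C \<xi> \<inter> ?C \<xi>' = {}"
      using cylinders_eqI[of _ K] by force
  qed (use finite_cylinders[OF finK] finite_exit_configs[OF assms(1)] in auto)
  moreover have "(\<Union>\<xi>\<in>cylinders K. ?C \<xi>) = exit_configs K D"
  proof safe
    fix \<zeta> assume \<zeta>: "\<zeta> \<in> exit_configs K D"
    then have "restrict \<zeta> K \<in> cylinders K"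
      using exit_configs_less_deg[OF assms(1)] assms(2) by (auto simp: cylinders_def)
    then show "\<zeta> \<in> (\<Union>\<xi>\<in>cylinders K. ?C \<xi>)" using \<zeta> by (intro UN_I[of "restrict \<zeta> K"]) auto
  qed
  ultimately have "(\<Sum>\<xi>\<in>cylinders K. card (?C \<xi>)) = card (exit_trees K D)"
    using card_exit_configs[OF assms(1)] by simp
  from arg_cong[OF this, of real]
  have "(\<Sum>\<xi>\<in>cylinders K. real (card (?C \<xi>))) = real (card (exit_trees K D))"
    by (simp only: of_nat_sum)
  then have "(\<Sum>\<xi>\<in>cylinders K. exit_ratio K D \<xi>) = real (card (exit_trees K D)) / card (exit_trees K D)"
    by (simp add: exit_ratio_def sum_divide_distrib[symmetric])
  then show ?thesis using finite_exit_trees[OF assms(1), of K] by simp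
qed

end

context finite_sandpile
begin

lemma wired_spanning_tree_iff: "wired_spanning_tree adj W T \<longleftrightarrow> T \<in> wired_trees W E"
proof -
  \<comment> \<open>Since \<open>V\<close> is infinite there is a point outside \<open>W\<close>,
    and any such point represents \<open>None\<close>.\<close>
  obtain s0 where s0: "s0 \<notin> W" using inf finW WV by (metis finite_subset subsetI)
  have "wired_conn W T (Some x) None \<longleftrightarrow> (\<exists>s. s \<notin> W \<and> wconn W T x s)" if "x \<in> W" for x
  proof -
    have "wired_conn W T (Some x) None \<longleftrightarrow> wconn W T x s" if "s \<notin> W" for s
      using wired_conn_iff_wconn[of W T x s] \<open>x \<in> W\<close> that by (simp add: wq_def)
    then show ?thesis using s0 by blast
  qed
  then show ?thesis
    by (simp add: wired_spanning_tree_def wired_trees_def wired_connected_def wired_acyclic_def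
        wired_conn_iff_wconn) blast
qed

lemma card_A: "card A = card (wired_trees W E)" "card A > 0"
proof -
  show "card A = card (wired_trees W E)"
    by (rule card_allowed_configs_eq_card_wired_trees[OF wired_graph_wired_edges[OF finW]])
  show "card A > 0"
    using max_config_allowed finite_A unfolding card_gt_0_iff by blast
qed

lemma prob_wired_ust:
  "measure_pmf.prob (wired_ust adj W) X = card (wired_trees W E \<inter> X) / card A"
proof -
  have "{T. wired_spanning_tree adj W T} = wired_trees W E" using wired_spanning_tree_iff by auto
  moreover have "finite (wired_trees W E)"
    using finite_wired_trees[OF wired_graph_wired_edges[OF finW]] .
  moreover have "wired_trees W E \<noteq> {}" using card_A by auto
  ultimately show ?thesis by (simp add: wired_ust_def measure_pmf_of_set card_A)
qed

lemma prob_sandpile: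
  "measure_pmf.prob (sandpile_measure adj W) X = card (A \<inter> X) / card A"
proof -
  have "{\<eta>. recurrent adj W \<eta>} = A" using recurrent_iff_allowed by auto
  moreover have "A \<noteq> {}" using card_A(2) by auto
  ultimately show ?thesis using finite_A by (simp add: sandpile_measure_def measure_pmf_of_set)
qed

lemma set_pmf_sandpile: "set_pmf (sandpile_measure adj W) = A"
proof -
  have "{\<eta>. recurrent adj W \<eta>} = A" using recurrent_iff_allowed by auto
  moreover have "A \<noteq> {}" using card_A(2) by auto
  ultimately show ?thesis using finite_A by (simp add: sandpile_measure_def)
qed

text \<open>The factor \<open>exit_ratio\<close> cancels the number of trees inside \<open>D\<close>
  and puts the number of configurations with heights \<xi> in its place; outside \<open>D\<close>
  trees become configurations by equinumerosity, and both laws share the denominator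
  \<open>card A\<close>.\<close>

lemma exit_ratio_prob_le:
  assumes "D \<subseteq> W"
  shows "exit_ratio K D \<xi> * measure_pmf.prob (wired_ust adj W) (exit_event K D) \<le>
    real (card {\<zeta> \<in> exit_configs K D. \<forall>x\<in>K. \<zeta> x = \<xi> x} *
      card (allowed_configs (W - D) (E - touching E D))) / card A"
proof (cases "card (exit_trees K D) = 0")
  case False
  have G: "wired_graph W E" using wired_graph_wired_edges[OF finW] .
  have H: "exit_edges E K D = exit_edges (edges adj) K D" "touching E D = touching (edges adj) D"
    using exit_edges_wired_edges[OF assms] touching_wired_edges[OF assms] by auto
  have "card (wired_trees W E \<inter> exit_event K D) =
      card {T \<in> wired_trees W E. T \<inter> touching E D \<in> wired_trees D (exit_edges E K D)}"
    by (rule arg_cong[where f = card]) (auto simp: exit_event_def exit_trees_def H)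
  also have "\<dots> \<le> card (exit_trees K D) * card (wired_trees (W - D) (E - touching E D))"
    using card_wired_trees_exit_le[OF G assms, of K] by (simp add: exit_trees_def H)
  also have "card (wired_trees (W - D) (E - touching E D)) =
      card (allowed_configs (W - D) (E - touching E D))"
    by (rule card_allowed_configs_eq_card_wired_trees[OF wired_graph_remove[OF G], symmetric])
  finally have "real (card (wired_trees W E \<inter> exit_event K D)) \<le>
      real (card (exit_trees K D)) * real (card (allowed_configs (W - D) (E - touching E D)))"
    by (metis of_nat_le_iff of_nat_mult)
  then have "real (card (wired_trees W E \<inter> exit_event K D)) / card (exit_trees K D) \<le>
      real (card (allowed_configs (W - D) (E - touching E D)))"
    using False by (simp add: divide_simps mult.commute)
  then have "card {\<zeta> \<in> exit_configs K D. \<forall>x\<in>K. \<zeta> x = \<xi> x} *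
      (real (card (wired_trees W E \<inter> exit_event K D)) / card (exit_trees K D)) / card A \<le>
      card {\<zeta> \<in> exit_configs K D. \<forall>x\<in>K. \<zeta> x = \<xi> x} *
      real (card (allowed_configs (W - D) (E - touching E D))) / card A"
    by (intro divide_right_mono mult_left_mono) auto
  then show ?thesis by (simp add: exit_ratio_def prob_wired_ust)
qed (simp add: exit_ratio_def)

text \<open>The bridge between the two models: summed over \<open>D\<close>, the bounds count
  distinct glued configurations.\<close>

lemma sum_exit_ratio_prob_le:
  assumes "finite \<D>" "\<And>D. D \<in> \<D> \<Longrightarrow> K \<subseteq> D \<and> D \<subseteq> W"
  shows "(\<Sum>D\<in>\<D>. exit_ratio K D \<xi> * measure_pmf.prob (wired_ust adj W) (exit_event K D)) \<le>
    measure_pmf.prob (sandpile_measure adj W) {\<eta>. \<forall>x\<in>K. \<eta> x = \<xi> x}"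
proof -
  let ?c = "\<lambda>D. card {\<zeta> \<in> exit_configs K D. \<forall>x\<in>K. \<zeta> x = \<xi> x} *
      card (allowed_configs (W - D) (E - touching E D))"
  have "(\<Sum>D\<in>\<D>. exit_ratio K D \<xi> * measure_pmf.prob (wired_ust adj W) (exit_event K D)) \<le>
      (\<Sum>D\<in>\<D>. real (?c D) / card A)"
    using assms(2) by (intro sum_mono exit_ratio_prob_le) auto
  also have "\<dots> = real (\<Sum>D\<in>\<D>. ?c D) / card A"
    by (simp add: sum_divide_distrib)
  also have "\<dots> \<le> real (card (A \<inter> {\<eta>. \<forall>x\<in>K. \<eta> x = \<xi> x})) / card A"
  proof (intro divide_right_mono of_nat_mono)
    have "(\<Sum>D\<in>\<D>. ?c D) = (\<Sum>D\<in>\<D>. card {\<zeta> \<in> allowed_configs D (exit_edges E K D). \<forall>x\<in>K. \<zeta> x = \<xi> x} *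
        card (allowed_configs (W - D) (E - touching E D)))"
      using assms(2) by (intro sum.cong) (auto simp: exit_configs_def exit_edges_wired_edges)
    also have "\<dots> \<le> card {\<eta> \<in> A. \<forall>x\<in>K. \<eta> x = \<xi> x}"
      using sum_card_allowed_configs_le[OF wired_graph_wired_edges[OF finW] assms] .
    finally show "(\<Sum>D\<in>\<D>. ?c D) \<le> card (A \<inter> {\<eta>. \<forall>x\<in>K. \<eta> x = \<xi> x})"
      by (simp add: Int_def)
  qed simp
  finally show ?thesis by (simp add: prob_sandpile)
qed

lemma sum_prob_sandpile_cylinders_le:
  assumes "finite K"
  shows "(\<Sum>\<xi>\<in>cylinders K. measure_pmf.prob (sandpile_measure adj W) {\<eta>. \<forall>x\<in>K. \<eta> x = \<xi> x}) \<le> 1"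
proof -
  let ?C = "\<lambda>\<xi>. {\<eta>. \<forall>x\<in>K. \<eta> x = \<xi> x}"
  have "disjoint_family_on ?C (cylinders K)"
    using cylinders_eqI[of _ K] unfolding disjoint_family_on_def by force
  then have "(\<Sum>\<xi>\<in>cylinders K. measure_pmf.prob (sandpile_measure adj W) (?C \<xi>)) =
      measure_pmf.prob (sandpile_measure adj W) (\<Union>\<xi>\<in>cylinders K. ?C \<xi>)"
    using finite_cylinders[OF assms]
    by (intro measure_pmf.finite_measure_finite_Union[symmetric]) auto
  then show ?thesis by simp
qed

end

section \<open>Infinite-volume limit\<close>

text \<open>With total mass at most one and lower bounds adding up to at least one, a coordinate
  that exceeds its limit forces another one to fall short.\<close>

lemma tendsto_from_lower_bounds:
  fixes x :: "nat \<Rightarrow> 'b \<Rightarrow> real"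
  assumes S: "finite S" and total: "eventually (\<lambda>n. (\<Sum>s\<in>S. x n s) \<le> 1) sequentially"
    and lower: "\<And>s \<epsilon>. s \<in> S \<Longrightarrow> \<epsilon> > 0 \<Longrightarrow> eventually (\<lambda>n. x n s \<ge> l s - \<epsilon>) sequentially"
    and mass: "(\<Sum>s\<in>S. l s) \<ge> 1" and s: "s \<in> S"
  shows "(\<lambda>n. x n s) \<longlonglongrightarrow> l s"
proof (rule tendstoI)
  fix \<epsilon> :: real assume \<epsilon>: "\<epsilon> > 0"
  \<comment> \<open>Each of the \<open>card S\<close> coordinates may fall short by \<delta>;
    together this costs half of \<epsilon>.\<close>
  define \<delta> where "\<delta> = \<epsilon> / (2 * card S)"
  have cS: "card S > 0" using S s by (auto simp: card_gt_0_iff)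
  then have \<delta>: "\<delta> > 0" using \<epsilon> by (simp add: \<delta>_def)
  have card_\<delta>: "card S * \<delta> = \<epsilon> / 2" using cS by (simp add: \<delta>_def)
  have "eventually (\<lambda>n. \<forall>t\<in>S. x n t \<ge> l t - \<delta>) sequentially"
    using S lower \<delta> by (intro eventually_ball_finite) auto
  with total show "eventually (\<lambda>n. dist (x n s) (l s) < \<epsilon>) sequentially"
  proof eventually_elim
    case (elim n)
    have "(\<Sum>t\<in>S - {s}. l t - \<delta>) \<le> (\<Sum>t\<in>S - {s}. x n t)"
      using elim by (intro sum_mono) auto
    then have "(\<Sum>t\<in>S. l t) - l s - card (S - {s}) * \<delta> \<le> (\<Sum>t\<in>S. x n t) - x n s"
      using S s by (simp add: sum_subtractf sum_diff1)
    moreover have "real (card (S - {s})) * \<delta> \<le> card S * \<delta>"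
      using \<delta> S by (intro mult_right_mono) (auto intro: card_mono)
    moreover have "\<delta> \<le> card S * \<delta>" using \<delta> cS by (simp add: mult_le_cancel_right1)
    moreover have "l s - \<delta> \<le> x n s" using elim(2) s by blast
    ultimately have "x n s - l s \<le> \<epsilon> / 2" "l s - x n s \<le> \<epsilon> / 2"
      using elim(1) mass card_\<delta> by linarith+
    then show ?case using \<epsilon> by (simp add: dist_real_def abs_less_iff)
  qed
qed

context sandpile_graph
begin

lemma finite_subset_exhaustion:
  assumes "exhaustion V Vn" "finite D" "D \<subseteq> V"
  shows "eventually (\<lambda>n. D \<subseteq> Vn n) sequentially"
proof -
  have mono: "Vn i \<subseteq> Vn j" if "i \<le> j" for i j
  proof -
    have "Vn n \<subseteq> Vn (Suc n)" for n using assms(1) by (simp add: exhaustion_def)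
    then show ?thesis using that by (rule lift_Suc_mono_le)
  qed
  have "eventually (\<lambda>n. x \<in> Vn n) sequentially" if "x \<in> D" for x
  proof -
    have "x \<in> (\<Union>n. Vn n)" using assms(1,3) that by (auto simp: exhaustion_def)
    then obtain i where "x \<in> Vn i" by blast
    then show ?thesis using mono by (intro eventually_sequentiallyI[of i]) blast
  qed
  then have "eventually (\<lambda>n. \<forall>x\<in>D. x \<in> Vn n) sequentially"
    using assms(2) by (intro eventually_ball_finite) auto
  then show ?thesis by eventually_elim blast
qed

lemma exhaustion_finite_sandpile:
  assumes "exhaustion V Vn" shows "finite_sandpile V adj (Vn n)"
  using assms by unfold_locales (auto simp: exhaustion_def)

text \<open>Balls around a vertex are finite by local finiteness and exhaust \<open>V\<close> by
  connectedness.\<close>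

lemma exhaustion_exists: "\<exists>Vn. exhaustion V Vn"
proof -
  obtain x0 where x0: "x0 \<in> V" using inf by fastforce
  define B where "B = rec_nat {x0} (\<lambda>_ S. S \<union> (\<Union>x\<in>S. {y. adj x y}))"
  have B: "B 0 = {x0}" "B (Suc n) = B n \<union> (\<Union>x\<in>B n. {y. adj x y})" for n
    by (simp_all add: B_def)
  have "finite (B n)" for n by (induction n) (simp_all add: B)
  moreover have "B n \<subseteq> V" for n
    by (induction n) (use x0 adj_V in \<open>auto simp: B\<close>)
  moreover have "\<exists>n. y \<in> B n" if "adj\<^sup>*\<^sup>* x0 y" for y
    using that
  proof (induction rule: rtranclp_induct)
    case base
    then show ?case using B(1) by blast
  next
    case (step y z)
    then obtain n where "y \<in> B n" by blast
    then have "z \<in> B (Suc n)" using step.hyps by (auto simp: B)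
    then show ?case by blast
  qed
  then have "V \<subseteq> (\<Union>n. B n)" using conn x0 by (auto simp: graph_connected_def)
  ultimately show ?thesis unfolding exhaustion_def by (intro exI[of _ B]) (auto simp: B)
qed

end

locale one_ended_wsf = sandpile_graph +
  fixes \<mu> :: "('a set \<Rightarrow> bool) measure"
  assumes WSF: "is_WSF V adj \<mu>"
    and one_end: "AE \<omega> in \<mu>. single_tree V (open_edges adj \<omega>) \<and> one_ended (open_edges adj \<omega>)"
begin

sublocale prob_space \<mu>
  using WSF by (simp add: is_WSF_def)

lemma sets_\<mu>: "sets \<mu> = sets (edge_space adj)"
  using WSF by (simp add: is_WSF_def)

definition exit_set :: "'a set \<Rightarrow> 'a set \<Rightarrow> ('a set \<Rightarrow> bool) set" where
  "exit_set K D = {\<omega> \<in> space \<mu>. open_edges adj \<omega> \<in> exit_event K D}"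

definition edge_cylinder :: "'a set set \<Rightarrow> 'a set set \<Rightarrow> ('a set \<Rightarrow> bool) set" where
  "edge_cylinder S T = {\<omega> \<in> space \<mu>. \<forall>e\<in>S. \<omega> e \<longleftrightarrow> e \<in> T}"

lemma edge_cylinder_sets:
  assumes "finite S" "S \<subseteq> edges adj"
  shows "edge_cylinder S T \<in> sets \<mu>"
proof -
  have "{\<omega> \<in> space (edge_space adj). \<omega> e \<longleftrightarrow> e \<in> T} \<in> sets (edge_space adj)" if "e \<in> S" for e
  proof -
    have "(\<lambda>\<omega>. \<omega> e) \<in> measurable (edge_space adj) (count_space UNIV)"
      unfolding edge_space_def using that assms by (intro measurable_component_singleton) auto
    from measurable_sets[OF this, of "{e \<in> T}"]
    show ?thesis by (simp add: vimage_def Int_def conj_commute)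
  qed
  then have "{\<omega> \<in> space (edge_space adj). \<forall>e\<in>S. \<omega> e \<longleftrightarrow> e \<in> T} \<in> sets (edge_space adj)"
    using assms(1) by (intro sets.sets_Collect_finite_All) auto
  then show ?thesis
    using sets_\<mu> sets_eq_imp_space_eq[OF sets_\<mu>] by (simp add: edge_cylinder_def)
qed

lemma exit_trees_touching: "T \<in> exit_trees K D \<Longrightarrow> T \<subseteq> touching (edges adj) D"
  by (auto simp: exit_trees_def wired_trees_def exit_edges_def touching_def)

text \<open>For finite \<open>D\<close> this is a finite disjoint union of cylinders on finitely
  many edges, which gives both measurability and convergence of the probabilities.\<close>

lemma exit_set_eq:
  "exit_set K D = (\<Union>T\<in>exit_trees K D. edge_cylinder (touching (edges adj) D) T)"
proof -
  have "open_edges adj \<omega> \<inter> touching (edges adj) D = T \<longleftrightarrow>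
      (\<forall>e\<in>touching (edges adj) D. \<omega> e \<longleftrightarrow> e \<in> T)" if "T \<in> exit_trees K D" for \<omega> T
    using exit_trees_touching[OF that] by (auto simp: open_edges_def touching_def)
  then have "open_edges adj \<omega> \<in> exit_event K D \<longleftrightarrow>
      (\<exists>T\<in>exit_trees K D. \<forall>e\<in>touching (edges adj) D. \<omega> e \<longleftrightarrow> e \<in> T)" for \<omega>
    unfolding exit_event_def mem_Collect_eq by metis
  then show ?thesis unfolding exit_set_def edge_cylinder_def by blast
qed

lemma exit_set_sets:
  assumes "finite D" shows "exit_set K D \<in> sets \<mu>"
  unfolding exit_set_eq using finite_exit_trees[OF assms] finite_touching[OF assms]
  by (intro sets.finite_UN edge_cylinder_sets) (auto simp: touching_def)

lemma prob_exit_event_tendsto: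
  assumes ex: "exhaustion V Vn" and D: "finite D"
  shows "(\<lambda>n. measure_pmf.prob (wired_ust adj (Vn n)) (exit_event K D)) \<longlonglongrightarrow> prob (exit_set K D)"
proof -
  let ?S = "touching (edges adj) D" and ?\<T> = "exit_trees K D"
  have S: "finite ?S" "?S \<subseteq> edges adj" using finite_touching[OF D] by (auto simp: touching_def)
  have "exit_event K D = (\<Union>T\<in>?\<T>. {F. F \<inter> ?S = T})" by (auto simp: exit_event_def)
  moreover have "measure_pmf.prob p (\<Union>T\<in>?\<T>. {F. F \<inter> ?S = T}) =
      (\<Sum>T\<in>?\<T>. measure_pmf.prob p {F. F \<inter> ?S = T})" for p
    using finite_exit_trees[OF D]
    by (intro measure_pmf.finite_measure_finite_Union) (auto simp: disjoint_family_on_def)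
  moreover have "prob (exit_set K D) = (\<Sum>T\<in>?\<T>. prob (edge_cylinder ?S T))"
    unfolding exit_set_eq
  proof (rule finite_measure_finite_Union)
    show "disjoint_family_on (edge_cylinder ?S) ?\<T>"
      unfolding disjoint_family_on_def edge_cylinder_def
      using exit_trees_touching[of _ K D] by (auto 4 3)
  qed (use finite_exit_trees[OF D] edge_cylinder_sets[OF S] in auto)
  moreover have "(\<lambda>n. measure_pmf.prob (wired_ust adj (Vn n)) {F. F \<inter> ?S = T})
      \<longlonglongrightarrow> prob (edge_cylinder ?S T)" if "T \<in> ?\<T>" for T
    using WSF ex S exit_trees_touching[OF that] unfolding is_WSF_def edge_cylinder_def by blast
  ultimately show ?thesis by (simp add: tendsto_sum)
qed

text \<open>One-endedness enters the limit here: almost every forest has a finite exit set, which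
  lies in some \<open>Vn n\<close>.\<close>

lemma prob_exit_sets_tendsto:
  assumes K: "finite K" "K \<subseteq> V" and ex: "exhaustion V Vn"
  shows "(\<lambda>n. prob (\<Union>D\<in>{D. K \<subseteq> D \<and> D \<subseteq> Vn n}. exit_set K D)) \<longlonglongrightarrow> 1"
proof -
  let ?M = "\<lambda>n. \<Union>D\<in>{D. K \<subseteq> D \<and> D \<subseteq> Vn n}. exit_set K D"
  have fin: "finite (Vn n)" and sub: "Vn n \<subseteq> Vn (Suc n)" for n
    using ex by (auto simp: exhaustion_def)
  have meas: "?M n \<in> sets \<mu>" for n
    using fin[of n] by (intro sets.finite_UN exit_set_sets) (auto intro: finite_subset)
  have "incseq ?M"
  proof (rule incseq_SucI)
    show "?M n \<le> ?M (Suc n)" for n using sub[of n] by blast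
  qed
  then have "(\<lambda>n. prob (?M n)) \<longlonglongrightarrow> prob (\<Union>n. ?M n)"
    using meas by (intro finite_Lim_measure_incseq) auto
  moreover have "AE \<omega> in \<mu>. \<omega> \<in> (\<Union>n. ?M n)"
    using one_end AE_space
  proof eventually_elim
    case (elim \<omega>)
    have "open_edges adj \<omega> \<subseteq> edges adj" by (auto simp: open_edges_def)
    then obtain D where D: "finite D" "K \<subseteq> D" "D \<subseteq> V"
      "open_edges adj \<omega> \<inter> touching (edges adj) D \<in> wired_trees D (exit_edges (edges adj) K D)"
      using finite_exit_set[of "open_edges adj \<omega>" K] elim K by blast
    then have "\<omega> \<in> exit_set K D" using elim by (simp add: exit_set_def exit_event_def exit_trees_def)
    moreover obtain n where "D \<subseteq> Vn n"
      using eventually_happens[OF finite_subset_exhaustion[OF ex D(1,3)]] by auto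
    ultimately show ?case using D by blast
  qed
  then have "prob (\<Union>n. ?M n) = 1"
    using meas by (subst prob_eq_1) auto
  ultimately show ?thesis by simp
qed

theorem sandpile_tendsto:
  assumes K: "finite K" "K \<subseteq> V"
  shows "\<exists>l. \<forall>Xn. exhaustion V Xn \<longrightarrow> (\<forall>\<xi>\<in>cylinders K.
    (\<lambda>n. measure_pmf.prob (sandpile_measure adj (Xn n)) {\<eta>. \<forall>x\<in>K. \<eta> x = \<xi> x}) \<longlonglongrightarrow> l \<xi>)"
proof -
  obtain Vn where ex: "exhaustion V Vn" using exhaustion_exists by blast
  have finV: "finite (Vn n)" and subV: "Vn n \<subseteq> V" and mono: "Vn n \<subseteq> Vn (Suc n)" for n
    using ex by (auto simp: exhaustion_def)
  define \<D> where "\<D> n = {D. K \<subseteq> D \<and> D \<subseteq> Vn n}" for n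
  have fin\<D>: "finite (\<D> n)" for n
    using finV[of n] by (auto simp: \<D>_def intro: finite_subset[of _ "Pow (Vn n)"])
  have finD: "finite D" if "D \<in> \<D> n" for D n
    using that finV[of n] by (auto simp: \<D>_def intro: finite_subset)
  \<comment> \<open>Here \<open>n\<close> truncates the exit sets by means of an auxiliary
    exhaustion, while \<open>N\<close> below indexes the volume of the sandpile. For fixed
    \<open>n\<close> the volume grows first, so the candidate limit is built from the forest alone
    and does not depend on \<open>Xn\<close>.\<close>
  define a where "a \<xi> n = (\<Sum>D\<in>\<D> n. exit_ratio K D \<xi> * prob (exit_set K D))" for \<xi> n
  let ?p = "\<lambda>Xn \<xi> N. measure_pmf.prob (sandpile_measure adj (Xn N)) {\<eta>. \<forall>x\<in>K. \<eta> x = \<xi> x}"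
  have approx: "\<exists>q. q \<longlonglongrightarrow> a \<xi> n \<and> eventually (\<lambda>N. q N \<le> ?p Xn \<xi> N) sequentially"
    if "exhaustion V Xn" for Xn \<xi> n
  proof (intro exI conjI)
    let ?q = "\<lambda>N. \<Sum>D\<in>\<D> n. exit_ratio K D \<xi> * measure_pmf.prob (wired_ust adj (Xn N)) (exit_event K D)"
    show "?q \<longlonglongrightarrow> a \<xi> n"
      unfolding a_def using prob_exit_event_tendsto[OF that finD] by (intro tendsto_intros) auto
    show "eventually (\<lambda>N. ?q N \<le> ?p Xn \<xi> N) sequentially"
      using finite_subset_exhaustion[OF that finV[of n] subV]
    proof eventually_elim
      case (elim N)
      interpret U: finite_sandpile V adj "Xn N" using exhaustion_finite_sandpile[OF that] .
      show ?case using elim by (intro U.sum_exit_ratio_prob_le fin\<D>) (auto simp: \<D>_def)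
    qed
  qed
  have a_le: "a \<xi> n \<le> 1" for \<xi> n
  proof -
    obtain q where q: "q \<longlonglongrightarrow> a \<xi> n" "eventually (\<lambda>N. q N \<le> ?p Vn \<xi> N) sequentially"
      using approx[OF ex] by blast
    have "eventually (\<lambda>N. q N \<le> 1) sequentially"
      using q(2) by eventually_elim (use measure_pmf.prob_le_1 order_trans in blast)
    then show ?thesis using q(1) by (intro tendsto_upperbound) auto
  qed
  have inc: "incseq (a \<xi>)" for \<xi>
  proof (rule incseq_SucI)
    show "a \<xi> n \<le> a \<xi> (Suc n)" for n
      unfolding a_def using mono[of n]
      by (intro sum_mono2 fin\<D>) (auto simp: \<D>_def exit_ratio_def)
  qed
  define l where "l \<xi> = lim (a \<xi>)" for \<xi>
  have l: "a \<xi> \<longlonglongrightarrow> l \<xi>" for \<xi>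
  proof -
    obtain L where "a \<xi> \<longlonglongrightarrow> L"
      using a_le by (auto intro: incseq_convergent[OF inc[of \<xi>], of 1])
    then show ?thesis unfolding l_def by (simp add: limI)
  qed
  \<comment> \<open>The exit events exhaust the probability space up to a null set, and their
    conditional laws sum to one. A union bound over \<open>D\<close> suffices for a lower bound on
    the mass.\<close>
  have mass: "(\<Sum>\<xi>\<in>cylinders K. l \<xi>) \<ge> 1"
  proof (rule LIMSEQ_le)
    show "(\<lambda>n. \<Sum>\<xi>\<in>cylinders K. a \<xi> n) \<longlonglongrightarrow> (\<Sum>\<xi>\<in>cylinders K. l \<xi>)"
      using l by (intro tendsto_sum)
    show "(\<lambda>n. prob (\<Union>D\<in>\<D> n. exit_set K D)) \<longlonglongrightarrow> 1"
      using prob_exit_sets_tendsto[OF K ex] by (simp add: \<D>_def)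
    have "prob (\<Union>D\<in>\<D> n. exit_set K D) \<le> (\<Sum>\<xi>\<in>cylinders K. a \<xi> n)" for n
    proof -
      have "prob (\<Union>D\<in>\<D> n. exit_set K D) \<le> (\<Sum>D\<in>\<D> n. prob (exit_set K D))"
        using fin\<D> exit_set_sets[OF finD] by (intro finite_measure_subadditive_finite) auto
      also have "\<dots> = (\<Sum>D\<in>\<D> n. (\<Sum>\<xi>\<in>cylinders K. exit_ratio K D \<xi>) * prob (exit_set K D))"
      proof (rule sum.cong)
        fix D assume D: "D \<in> \<D> n"
        have "exit_set K D = {}" if "exit_trees K D = {}" using that by (simp add: exit_set_eq)
        then show "prob (exit_set K D) = (\<Sum>\<xi>\<in>cylinders K. exit_ratio K D \<xi>) * prob (exit_set K D)"
          using sum_exit_ratio[OF finD[OF D], of K] D by (auto simp: \<D>_def)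
      qed simp
      also have "\<dots> = (\<Sum>\<xi>\<in>cylinders K. a \<xi> n)"
        unfolding a_def by (subst sum.swap) (simp add: sum_distrib_right)
      finally show ?thesis .
    qed
    then show "\<exists>N. \<forall>n\<ge>N. prob (\<Union>D\<in>\<D> n. exit_set K D) \<le> (\<Sum>\<xi>\<in>cylinders K. a \<xi> n)" by blast
  qed
  have "?p Xn \<xi> \<longlonglongrightarrow> l \<xi>" if U: "exhaustion V Xn" and \<xi>: "\<xi> \<in> cylinders K" for Xn \<xi>
  proof (rule tendsto_from_lower_bounds[of "cylinders K" "\<lambda>N \<xi>. ?p Xn \<xi> N"])
    show "eventually (\<lambda>N. (\<Sum>\<xi>\<in>cylinders K. ?p Xn \<xi> N) \<le> 1) sequentially"
    proof (rule always_eventually, rule allI)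
      fix N
      interpret U: finite_sandpile V adj "Xn N" using exhaustion_finite_sandpile[OF U] .
      show "(\<Sum>\<xi>\<in>cylinders K. ?p Xn \<xi> N) \<le> 1" using U.sum_prob_sandpile_cylinders_le[OF K(1)] .
    qed
    show "eventually (\<lambda>N. l \<xi> - \<epsilon> \<le> ?p Xn \<xi> N) sequentially" if "\<epsilon> > 0" for \<xi> \<epsilon>
    proof -
      have "eventually (\<lambda>n. l \<xi> - \<epsilon> / 2 < a \<xi> n) sequentially"
        using l[of \<xi>] that by (intro order_tendstoD(1)) auto
      then obtain n where n: "l \<xi> - \<epsilon> / 2 < a \<xi> n"
        using eventually_happens'[OF sequentially_bot] by blast
      obtain q where q: "q \<longlonglongrightarrow> a \<xi> n" "eventually (\<lambda>N. q N \<le> ?p Xn \<xi> N) sequentially"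
        using approx[OF U] by blast
      have "eventually (\<lambda>N. a \<xi> n - \<epsilon> / 2 < q N) sequentially"
        using q(1) that by (intro order_tendstoD(1)) auto
      with q(2) show ?thesis by eventually_elim (use n in linarith)
    qed
  qed (use finite_cylinders[OF K(1)] mass \<xi> in auto)
  then show ?thesis by blast
qed

end

section \<open>Finite-dimensional limits and their extension\<close>

lemma pmf_limit_exists:
  assumes S: "finite S" and supp: "eventually (\<lambda>n. set_pmf (q n) \<subseteq> S) sequentially"
    and lim: "\<And>s. s \<in> S \<Longrightarrow> (\<lambda>n. pmf (q n) s) \<longlonglongrightarrow> l s"
  shows "\<exists>p. set_pmf p \<subseteq> S \<and> (\<forall>s\<in>S. pmf p s = l s)"
proof -
  define f where "f s = (if s \<in> S then l s else 0)" for s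
  have nonneg: "l s \<ge> 0" if "s \<in> S" for s
    using lim[OF that] by (rule LIMSEQ_le_const) auto
  have "(\<lambda>n. \<Sum>s\<in>S. pmf (q n) s) \<longlonglongrightarrow> (\<Sum>s\<in>S. l s)"
    using lim by (intro tendsto_sum)
  moreover have "eventually (\<lambda>n. (\<Sum>s\<in>S. pmf (q n) s) = 1) sequentially"
    using supp by eventually_elim (rule sum_pmf_eq_1[OF S])
  then have "(\<lambda>n. \<Sum>s\<in>S. pmf (q n) s) \<longlonglongrightarrow> 1" by (rule tendsto_eventually)
  ultimately have "(\<Sum>s\<in>S. l s) = 1" by (rule LIMSEQ_unique)
  then have "(\<integral>\<^sup>+s. ennreal (f s) \<partial>count_space UNIV) = 1"
    using S nonneg by (subst nn_integral_count_space'[of S]) (auto simp: f_def)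
  moreover have "0 \<le> f s" for s using nonneg by (simp add: f_def)
  ultimately have pmf: "pmf (embed_pmf f) s = f s" for s by (intro pmf_embed_pmf)
  then have "set_pmf (embed_pmf f) \<subseteq> S" by (auto simp: set_pmf_eq f_def split: if_splits)
  then show ?thesis using pmf by (intro exI[of _ "embed_pmf f"]) (simp add: f_def)
qed

lemma pmf_tendsto_outside:
  assumes supp: "eventually (\<lambda>n. set_pmf (q n) \<subseteq> S) sequentially" "set_pmf p \<subseteq> S"
    and lim: "\<And>s. s \<in> S \<Longrightarrow> (\<lambda>n. pmf (q n) s) \<longlonglongrightarrow> pmf p s"
  shows "(\<lambda>n. pmf (q n) s) \<longlonglongrightarrow> pmf p s"
proof (cases "s \<in> S")
  case False
  have "eventually (\<lambda>n. pmf (q n) s = 0) sequentially"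
    using supp(1) by eventually_elim (use False in \<open>auto simp: pmf_eq_0_set_pmf\<close>)
  moreover have "pmf p s = 0" using False supp(2) by (auto simp: pmf_eq_0_set_pmf)
  ultimately show ?thesis by (simp add: tendsto_eventually)
qed (rule lim)

text \<open>An eventually common finite support turns each image mass into a finite sum, which
  passes to the limit; this carries consistency of the marginals over to their limits.\<close>

lemma pmf_map_tendsto:
  assumes S: "finite S" and supp: "eventually (\<lambda>n. set_pmf (q n) \<subseteq> S) sequentially" "set_pmf p \<subseteq> S"
    and lim: "\<And>s. (\<lambda>n. pmf (q n) s) \<longlonglongrightarrow> pmf p s"
  shows "(\<lambda>n. pmf (map_pmf g (q n)) t) \<longlonglongrightarrow> pmf (map_pmf g p) t"
proof -
  have eq: "pmf (map_pmf g r) t = (\<Sum>s\<in>S \<inter> g -` {t}. pmf r s)" if "set_pmf r \<subseteq> S" for r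
  proof -
    have "pmf (map_pmf g r) t = measure_pmf.prob r (g -` {t} \<inter> set_pmf r)"
      by (simp add: pmf_map measure_Int_set_pmf)
    also have "g -` {t} \<inter> set_pmf r = (S \<inter> g -` {t}) \<inter> set_pmf r" using that by auto
    also have "measure_pmf.prob r \<dots> = (\<Sum>s\<in>S \<inter> g -` {t}. pmf r s)"
      using S by (simp add: measure_Int_set_pmf measure_measure_pmf_finite)
    finally show ?thesis .
  qed
  have "(\<lambda>n. \<Sum>s\<in>S \<inter> g -` {t}. pmf (q n) s) \<longlonglongrightarrow> pmf (map_pmf g p) t"
    unfolding eq[OF supp(2)] using lim by (intro tendsto_sum)
  moreover have "eventually (\<lambda>n. pmf (map_pmf g (q n)) t = (\<Sum>s\<in>S \<inter> g -` {t}. pmf (q n) s)) sequentially"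
    using supp(1) by eventually_elim (rule eq)
  ultimately show ?thesis by (simp add: tendsto_cong)
qed

text \<open>The natural numbers are embedded into the reals because the library states Kolmogorov's
extension theorem for Polish spaces, and nat is not declared as one.\<close>

lemma kolmogorov_extension_finite:
  fixes p :: "'a set \<Rightarrow> ('a \<Rightarrow> nat) pmf"
  assumes supp: "\<And>J. finite J \<Longrightarrow> J \<subseteq> V \<Longrightarrow> set_pmf (p J) \<subseteq> (\<Pi>\<^sub>E x\<in>J. {..<d x})"
    and cons: "\<And>J H. J \<subseteq> H \<Longrightarrow> finite H \<Longrightarrow> H \<subseteq> V \<Longrightarrow> map_pmf (\<lambda>f. restrict f J) (p H) = p J"
    and pos: "\<And>x. x \<in> V \<Longrightarrow> d x > 0"
  shows "\<exists>\<nu>. prob_space \<nu> \<and> sets \<nu> = sets (PiM V (\<lambda>x. count_space {0..<d x})) \<and>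
    (\<forall>K \<xi>. finite K \<and> K \<subseteq> V \<longrightarrow>
      measure \<nu> {\<eta> \<in> space \<nu>. \<forall>x\<in>K. \<eta> x = \<xi> x} = pmf (p K) (restrict \<xi> K))"
proof -
  let ?B = "\<lambda>J. PiM J (\<lambda>_. borel :: real measure)"
  define emb where "emb J f = (\<lambda>x\<in>J. real (f x))" for J and f :: "'a \<Rightarrow> nat"
  define P where "P J = distr (measure_pmf (p J)) (?B J) (emb J)" for J
  have emb_space: "emb J f \<in> space (?B J)" for J f by (simp add: emb_def space_PiM)
  have emb_meas: "emb J \<in> measurable (measure_pmf r) (?B J)" for J r
    using emb_space by (simp add: measurable_def)
  interpret polish_projective V P
  proof (intro polish_projective.intro projective_family.intro, goal_cases)
    case (1 J H)
    have "distr (P H) (?B J) (\<lambda>f. restrict f J) = distr (measure_pmf (p H)) (?B J) ((\<lambda>f. restrict f J) \<circ> emb H)"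
      unfolding P_def using 1 emb_meas by (intro distr_distr measurable_restrict_subset) auto
    also have "(\<lambda>f. restrict f J) \<circ> emb H = emb J \<circ> (\<lambda>f. restrict f J)"
      using 1 by (auto simp: emb_def fun_eq_iff)
    also have "distr (measure_pmf (p H)) (?B J) (emb J \<circ> (\<lambda>f. restrict f J)) =
        distr (distr (measure_pmf (p H)) (count_space UNIV) (\<lambda>f. restrict f J)) (?B J) (emb J)"
      using emb_space by (intro distr_distr[symmetric]) (auto simp: measurable_def)
    also have "distr (measure_pmf (p H)) (count_space UNIV) (\<lambda>f. restrict f J) = measure_pmf (p J)"
      using cons[OF 1] by (simp add: map_pmf_rep_eq[symmetric])
    finally show ?case unfolding P_def[of J] by (rule sym)
  next
    case (2 J)
    show ?case unfolding P_def using emb_meas by (rule measure_pmf.prob_space_distr)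
  qed
  let ?O = "PiM V (\<lambda>x. count_space {0..<d x})"
  \<comment> \<open>A measurable left inverse of the embedding into the reals. A rounded value out
    of range is replaced by 0, which is admissible because \<open>d x > 0\<close>; so \<tau> lands
    in the product space everywhere and not only almost surely.\<close>
  define cut where "cut x r = (if nat \<lfloor>r\<rfloor> < d x then nat \<lfloor>r\<rfloor> else 0)" for x and r :: real
  have cut_real: "cut x (real k) = k" if "k < d x" for x k using that by (simp add: cut_def)
  have cut_meas_UNIV: "cut x \<in> measurable borel (count_space UNIV)" for x
    unfolding cut_def by measurable
  have cut_meas: "cut x \<in> measurable borel (count_space {0..<d x})" if "x \<in> V" for x
    using cut_meas_UNIV[of x] pos[OF that] by (auto simp: cut_def measurable_def space_count_space)
  define \<tau> where "\<tau> \<omega> = (\<lambda>x\<in>V. cut x (\<omega> x))" for \<omega>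
  have \<tau>: "\<tau> \<in> measurable lim ?O"
  proof -
    have "(\<lambda>\<omega>. cut x (\<omega> x)) \<in> measurable (?B V) (count_space {0..<d x})" if "x \<in> V" for x
      using measurable_compose[OF measurable_component_singleton[OF that] cut_meas[OF that]] .
    then have "\<tau> \<in> measurable (?B V) ?O" unfolding \<tau>_def by (rule measurable_restrict)
    then show ?thesis by (simp cong: measurable_cong_sets)
  qed
  define \<nu> where "\<nu> = distr lim ?O \<tau>"
  have "prob_space \<nu>" unfolding \<nu>_def using \<tau> by (rule P.prob_space_distr)
  moreover have "sets \<nu> = sets ?O" by (simp add: \<nu>_def)
  moreover have "measure \<nu> {\<eta> \<in> space \<nu>. \<forall>x\<in>K. \<eta> x = \<xi> x} = pmf (p K) (restrict \<xi> K)"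
    if K: "finite K" "K \<subseteq> V" for K \<xi>
  proof -
    have ev: "{\<eta> \<in> space ?O. \<forall>x\<in>K. \<eta> x = \<xi> x} \<in> sets ?O"
    proof (rule sets.sets_Collect_finite_All[OF _ K(1)])
      fix x assume "x \<in> K"
      then have "(\<lambda>\<eta>. \<eta> x) \<in> measurable ?O (count_space {0..<d x})"
        using K by (intro measurable_component_singleton) auto
      from measurable_sets[OF this, of "{\<xi> x} \<inter> {0..<d x}"]
      have "(\<lambda>\<eta>. \<eta> x) -` ({\<xi> x} \<inter> {0..<d x}) \<inter> space ?O \<in> sets ?O" by simp
      moreover have "(\<lambda>\<eta>. \<eta> x) -` ({\<xi> x} \<inter> {0..<d x}) \<inter> space ?O = {\<eta> \<in> space ?O. \<eta> x = \<xi> x}"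
      proof -
        have "\<eta> x < d x" if "\<eta> \<in> space ?O" for \<eta>
          using that K \<open>x \<in> K\<close> by (auto simp: space_PiM PiE_iff)
        then show ?thesis by force
      qed
      ultimately show "{\<eta> \<in> space ?O. \<eta> x = \<xi> x} \<in> sets ?O" by simp
    qed
    define X where "X = {f \<in> space (?B K). \<forall>x\<in>K. cut x (f x) = \<xi> x}"
    have X: "X \<in> sets (?B K)"
      unfolding X_def
    proof (rule sets.sets_Collect_finite_All[OF _ K(1)])
      fix x assume x: "x \<in> K"
      have "(\<lambda>f. cut x (f x)) \<in> measurable (?B K) (count_space UNIV)"
        using measurable_compose[OF measurable_component_singleton[OF x] cut_meas_UNIV] .
      from measurable_sets[OF this, of "{\<xi> x}"]
      show "{f \<in> space (?B K). cut x (f x) = \<xi> x} \<in> sets (?B K)"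
        by (simp add: vimage_def Int_def conj_commute)
    qed
    have "measure \<nu> {\<eta> \<in> space \<nu>. \<forall>x\<in>K. \<eta> x = \<xi> x} = measure lim (\<tau> -` {\<eta> \<in> space ?O. \<forall>x\<in>K. \<eta> x = \<xi> x} \<inter> space lim)"
      unfolding \<nu>_def using measure_distr[OF \<tau> ev] by simp
    also have "\<tau> -` {\<eta> \<in> space ?O. \<forall>x\<in>K. \<eta> x = \<xi> x} \<inter> space lim = prod_emb V (\<lambda>_. borel) K X"
      using K measurable_space[OF \<tau>]
      by (auto simp: prod_emb_iff X_def space_PiM PiE_iff \<tau>_def subset_iff intro: extensional_arb)
    also have "measure lim (prod_emb V (\<lambda>_. borel) K X) = measure (P K) X"
      using K X by (intro measure_lim_emb) auto
    also have "\<dots> = measure_pmf.prob (p K) (emb K -` X)"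
      unfolding P_def using measure_distr[OF emb_meas X] by simp
    also have "\<dots> = measure_pmf.prob (p K) (emb K -` X \<inter> set_pmf (p K))"
      by (simp add: measure_Int_set_pmf)
    \<comment> \<open>The support consists of admissible heights, on which \<open>cut\<close>
      inverts the embedding.\<close>
    also have "emb K -` X \<inter> set_pmf (p K) = {restrict \<xi> K} \<inter> set_pmf (p K)"
    proof -
      have "emb K f \<in> X \<longleftrightarrow> f = restrict \<xi> K" if f: "f \<in> set_pmf (p K)" for f
      proof -
        have fK: "f \<in> (\<Pi>\<^sub>E x\<in>K. {..<d x})" using supp[OF K] f by auto
        then have "emb K f \<in> X \<longleftrightarrow> (\<forall>x\<in>K. f x = \<xi> x)"
          using emb_space[of K f] by (auto simp: X_def emb_def PiE_iff cut_real)
        also have "\<dots> \<longleftrightarrow> f = restrict \<xi> K"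
          using fK by (auto simp: PiE_iff fun_eq_iff extensional_def restrict_def)
        finally show ?thesis .
      qed
      then show ?thesis by auto
    qed
    also have "measure_pmf.prob (p K) \<dots> = pmf (p K) (restrict \<xi> K)"
      by (simp add: measure_Int_set_pmf measure_pmf_single)
    finally show ?thesis .
  qed
  ultimately show ?thesis by blast
qed

context one_ended_wsf
begin

lemma pmf_restrict_sandpile:
  "pmf (map_pmf (\<lambda>\<eta>. restrict \<eta> K) (sandpile_measure adj W)) (restrict \<xi> K) =
    measure_pmf.prob (sandpile_measure adj W) {\<eta>. \<forall>x\<in>K. \<eta> x = \<xi> x}"
proof -
  have "restrict \<eta> K = restrict \<xi> K \<longleftrightarrow> (\<forall>x\<in>K. \<eta> x = \<xi> x)" for \<eta>
    by (metis restrict_apply' restrict_ext)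
  then have "(\<lambda>\<eta>. restrict \<eta> K) -` {restrict \<xi> K} = {\<eta>. \<forall>x\<in>K. \<eta> x = \<xi> x}" by auto
  then show ?thesis by (simp add: pmf_map)
qed

lemma set_pmf_restrict_sandpile:
  assumes ex: "exhaustion V Vn" and J: "finite J" "J \<subseteq> V"
  shows "eventually (\<lambda>n. set_pmf (map_pmf (\<lambda>\<eta>. restrict \<eta> J) (sandpile_measure adj (Vn n))) \<subseteq> cylinders J)
    sequentially"
  using finite_subset_exhaustion[OF ex J]
proof eventually_elim
  case (elim n)
  interpret finite_sandpile V adj "Vn n" using exhaustion_finite_sandpile[OF ex] .
  show ?case using elim
    by (auto simp: set_pmf_sandpile A_iff stable_configs_def stable_def cylinders_def)
qed

lemma sandpile_limit_pmf:
  assumes J: "finite J" "J \<subseteq> V"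
  shows "\<exists>p. set_pmf p \<subseteq> cylinders J \<and> (\<forall>Vn. exhaustion V Vn \<longrightarrow> (\<forall>\<xi>.
    (\<lambda>n. pmf (map_pmf (\<lambda>\<eta>. restrict \<eta> J) (sandpile_measure adj (Vn n))) \<xi>) \<longlonglongrightarrow> pmf p \<xi>))"
proof -
  let ?q = "\<lambda>Vn n. map_pmf (\<lambda>\<eta>. restrict \<eta> J) (sandpile_measure adj (Vn n))"
  obtain l where l: "(\<lambda>n. pmf (?q Vn n) \<xi>) \<longlonglongrightarrow> l \<xi>"
    if "exhaustion V Vn" "\<xi> \<in> cylinders J" for Vn \<xi>
  proof -
    obtain l where l: "\<And>Vn \<xi>. exhaustion V Vn \<Longrightarrow> \<xi> \<in> cylinders J \<Longrightarrow>
      (\<lambda>n. measure_pmf.prob (sandpile_measure adj (Vn n)) {\<eta>. \<forall>x\<in>J. \<eta> x = \<xi> x}) \<longlonglongrightarrow> l \<xi>"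
      using sandpile_tendsto[OF J] by blast
    have "(\<lambda>n. pmf (?q Vn n) \<xi>) \<longlonglongrightarrow> l \<xi>"
      if "exhaustion V Vn" "\<xi> \<in> cylinders J" for Vn \<xi>
    proof -
      have "restrict \<xi> J = \<xi>" using that(2) by (auto simp: cylinders_def)
      then show ?thesis using pmf_restrict_sandpile[of J _ \<xi>] l[OF that] by simp
    qed
    then show ?thesis by (rule that)
  qed
  \<comment> \<open>One exhaustion serves to recognise \<open>l\<close> as a probability mass
    function; \<open>l\<close> itself is common to all exhaustions.\<close>
  obtain Bn where Bn: "exhaustion V Bn" using exhaustion_exists by blast
  obtain p where p: "set_pmf p \<subseteq> cylinders J" "\<forall>\<xi>\<in>cylinders J. pmf p \<xi> = l \<xi>"
    using pmf_limit_exists[OF finite_cylinders[OF J(1)] set_pmf_restrict_sandpile[OF Bn J] l[OF Bn]]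
    by blast
  have "(\<lambda>n. pmf (?q Vn n) \<xi>) \<longlonglongrightarrow> pmf p \<xi>" if "exhaustion V Vn" for Vn \<xi>
    using set_pmf_restrict_sandpile[OF that J] p(1)
    by (rule pmf_tendsto_outside) (use l[OF that] p(2) in auto)
  then show ?thesis using p(1) by blast
qed

theorem sandpile_limit_exists:
  "\<exists>\<nu>. prob_space \<nu> \<and> sets \<nu> = sets (Omega V adj) \<and>
    (\<forall>Vn. exhaustion V Vn \<longrightarrow> (\<forall>K \<xi>. finite K \<and> K \<subseteq> V \<longrightarrow>
      (\<lambda>n. measure_pmf.prob (sandpile_measure adj (Vn n)) {\<eta>. \<forall>x\<in>K. \<eta> x = \<xi> x})
        \<longlonglongrightarrow> measure \<nu> {\<eta> \<in> space \<nu>. \<forall>x\<in>K. \<eta> x = \<xi> x}))"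
proof -
  let ?q = "\<lambda>Vn J n. map_pmf (\<lambda>\<eta>. restrict \<eta> J) (sandpile_measure adj (Vn n))"
  obtain p where p: "\<And>J. finite J \<and> J \<subseteq> V \<Longrightarrow> set_pmf (p J) \<subseteq> cylinders J"
    and lim: "\<And>J Vn \<xi>. finite J \<and> J \<subseteq> V \<Longrightarrow> exhaustion V Vn \<Longrightarrow>
      (\<lambda>n. pmf (?q Vn J n) \<xi>) \<longlonglongrightarrow> pmf (p J) \<xi>"
  proof -
    define p where "p J = (SOME p. set_pmf p \<subseteq> cylinders J \<and> (\<forall>Vn. exhaustion V Vn \<longrightarrow>
      (\<forall>\<xi>. (\<lambda>n. pmf (?q Vn J n) \<xi>) \<longlonglongrightarrow> pmf p \<xi>)))" for J
    have "set_pmf (p J) \<subseteq> cylinders J \<and> (\<forall>Vn. exhaustion V Vn \<longrightarrow>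
      (\<forall>\<xi>. (\<lambda>n. pmf (?q Vn J n) \<xi>) \<longlonglongrightarrow> pmf (p J) \<xi>))" if "finite J \<and> J \<subseteq> V" for J
      unfolding p_def using that by (intro someI_ex[OF sandpile_limit_pmf]) auto
    then show ?thesis using that[of p] by blast
  qed
  obtain Bn where Bn: "exhaustion V Bn" using exhaustion_exists by blast
  \<comment> \<open>The marginals are consistent in each finite volume, restriction commutes with
    limits on finite supports, and uniqueness of limits gives consistency of
    \<open>p\<close>.\<close>
  have cons: "map_pmf (\<lambda>f. restrict f J) (p H) = p J" if "J \<subseteq> H" "finite H" "H \<subseteq> V" for J H
  proof (rule pmf_eqI)
    fix \<xi>
    have J: "finite J \<and> J \<subseteq> V" and H: "finite H \<and> H \<subseteq> V" using that finite_subset by auto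
    have "(\<lambda>n. pmf (map_pmf (\<lambda>f. restrict f J) (?q Bn H n)) \<xi>) \<longlonglongrightarrow> pmf (map_pmf (\<lambda>f. restrict f J) (p H)) \<xi>"
      using finite_cylinders[OF that(2)] set_pmf_restrict_sandpile[OF Bn that(2,3)] p[OF H]
      by (rule pmf_map_tendsto) (rule lim[OF H Bn])
    moreover have "map_pmf (\<lambda>f. restrict f J) (?q Bn H n) = ?q Bn J n" for n
      using that(1) by (simp add: pmf.map_comp o_def Int_absorb1)
    ultimately show "pmf (map_pmf (\<lambda>f. restrict f J) (p H)) \<xi> = pmf (p J) \<xi>"
      using LIMSEQ_unique lim[OF J Bn] by simp blast
  qed
  have "\<exists>\<nu>. prob_space \<nu> \<and> sets \<nu> = sets (Omega V adj) \<and> (\<forall>K \<xi>. finite K \<and> K \<subseteq> V \<longrightarrow>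
      measure \<nu> {\<eta> \<in> space \<nu>. \<forall>x\<in>K. \<eta> x = \<xi> x} = pmf (p K) (restrict \<xi> K))"
    unfolding Omega_def
  proof (rule kolmogorov_extension_finite)
    show "set_pmf (p J) \<subseteq> (\<Pi>\<^sub>E x\<in>J. {..<deg adj x})" if "finite J" "J \<subseteq> V" for J
      using p[of J] that by (simp add: cylinders_def)
  qed (fact cons deg_pos)+
  then obtain \<nu> where \<nu>: "prob_space \<nu>" "sets \<nu> = sets (Omega V adj)"
    and cyl: "\<And>K \<xi>. finite K \<and> K \<subseteq> V \<Longrightarrow>
      measure \<nu> {\<eta> \<in> space \<nu>. \<forall>x\<in>K. \<eta> x = \<xi> x} = pmf (p K) (restrict \<xi> K)"
    by auto
  have "(\<lambda>n. measure_pmf.prob (sandpile_measure adj (Vn n)) {\<eta>. \<forall>x\<in>K. \<eta> x = \<xi> x})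
        \<longlonglongrightarrow> measure \<nu> {\<eta> \<in> space \<nu>. \<forall>x\<in>K. \<eta> x = \<xi> x}"
    if "exhaustion V Vn" "finite K \<and> K \<subseteq> V" for Vn K \<xi>
    using lim[OF that(2,1), of "restrict \<xi> K"] cyl[OF that(2), of \<xi>] by (simp add: pmf_restrict_sandpile)
  then show ?thesis using \<nu>(1,2) by blast
qed

end

text \<open>Quantifying \<nu> before the exhaustion expresses independence of it. As each vertex has
  finitely many possible heights, the probabilities of these cylinders determine the
  finite-dimensional marginals and their convergence.\<close>

theorem theorem6p1:
  fixes V :: "'a set" and adj :: "'a \<Rightarrow> 'a \<Rightarrow> bool" and \<mu> :: "('a set \<Rightarrow> bool) measure"
  assumes "simple_graph V adj" and "infinite V" and "graph_connected V adj"
    and "locally_finite V adj"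
    and "is_WSF V adj \<mu>"
    and "AE \<omega> in \<mu>. single_tree V (open_edges adj \<omega>) \<and> one_ended (open_edges adj \<omega>)"
  shows "\<exists>\<nu>. prob_space \<nu> \<and> sets \<nu> = sets (Omega V adj) \<and>
    (\<forall>Vn. exhaustion V Vn \<longrightarrow>
       (\<forall>K \<xi>. finite K \<and> K \<subseteq> V \<longrightarrow>
          (\<lambda>n. measure_pmf.prob (sandpile_measure adj (Vn n)) {\<eta>. \<forall>x\<in>K. \<eta> x = \<xi> x})
            \<longlonglongrightarrow> measure \<nu> {\<eta> \<in> space \<nu>. \<forall>x\<in>K. \<eta> x = \<xi> x}))"
proof -
  interpret one_ended_wsf V adj \<mu>
    using assms by unfold_locales
  show ?thesis by (rule sandpile_limit_exists)
qed

end
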